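(* Let $I$ be a time interval containing $0$, $\mathbf r\in C^2(I;\mathbb R^3)$, $\mathbf v=\partial_t\mathbf r$, and $\mathbf y=\mathbf x-\mathbf r(t)$. Let the potentials have the form $$\varphi=\varphi_0(t)+\mathbf y\cdot\mathbf g(t)+\varphi_2(t,\mathbf y),\qquad \mathbf A=\mathbf A_0(t)+\mathbf A_1(t)\mathbf y+\nabla P_3(t,\mathbf y),$$ where $\varphi_0$ (real), $\mathbf g$, $\mathbf A_0$ ($\mathbb R^3$-valued) are given continuously differentiable functions of $t$, $\mathbf A_1(t)$ is an arbitrary real $3\times3$ matrix depending continuously differentiably on $t$, $P_3(t,\mathbf y)$ is real with a zero of at least third degree at $\mathbf y=0$, and $\nabla P_3$ is continuously differentiable in $(t,\mathbf y)$. Put $P_2(t,\mathbf y)=\frac12\mathbf y\cdot\mathbf A_1(t)\mathbf y$, $\breve{\mathbf A}(t,\mathbf y)=\frac12(\mathbf A_1(t)-\mathbf A_1^{\mathrm T}(t))\mathbf y$, and suppose $$\varphi_2(t,\mathbf y)=-\frac{q}{2m\mathrm c^2}\breve{\mathbf A}^2-\frac1{\mathrm c}\partial_t\left(P_2(t,\mathbf y)+P_3(t,\mathbf y)\right)+\frac1{\mathrm c}\mathbf v\cdot\nabla P_3(t,\mathbf y)$$ (with $\partial_t$ taken at fixed $\mathbf y$). Suppose that $\mathbf r(t)$ satisfies Newton's equation $$m\,\partial_t^2\mathbf r=q\mathbf E(t,\mathbf r)+\frac q{\mathrm c}\mathbf v\times\mathbf B(t,\mathbf r),\qquad \mathbf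 E=-\nabla\varphi-\frac1{\mathrm c}\partial_t\mathbf A,\quad\mathbf B=\nabla\times\mathbf A,$$ where the potentials are regarded as functions of $(t,\mathbf x)$. Then the wave-corpuscle $$\psi(t,\mathbf x)=e^{iS(t,\mathbf x-\mathbf r(t))}\,\mathring\psi_a(|\mathbf x-\mathbf r(t)|),$$ $$S(t,\mathbf y)=\frac m\chi\mathbf v\cdot\mathbf y+\frac{q}{\chi\mathrm c}\mathbf y\cdot\mathbf A_0(t)+s_{\mathrm p}(t)+s_{\mathrm p2}(t,\mathbf y),$$ $$s_{\mathrm p}(t)=\frac1\chi\int_0^t\left(\tfrac12m\mathbf v^2+\frac q{\mathrm c}\mathbf v\cdot\mathbf A_0-q\varphi_0\right)dt',\qquad s_{\mathrm p2}(t,\mathbf y)=\frac q{\chi\mathrm c}\int_0^1\mathbf y\cdot\left(\mathbf A_1(t)s\mathbf y+\nabla P_3(t,s\mathbf y)\right)ds,$$ is a solution of the NLS equation with size parameter $a$ and potentials $\varphi,\mathbf A$.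
   Context: $m,\chi,\mathrm c>0$ and $q\in\mathbb R$ are fixed constants. The NLS equation with potentials $\varphi,\mathbf A$ and size parameter $a>0$ is $$i\tilde\partial_t\psi=\frac\chi{2m}\left[-\tilde\nabla^2\psi+G_a'(\psi^*\psi)\psi\right],\qquad\tilde\partial_t=\partial_t+\frac{iq}\chi\varphi,\quad\tilde\nabla=\nabla-\frac{iq}{\chi\mathrm c}\mathbf A,$$ with $\psi(t,\mathbf x)$ complex valued, $\mathbf x\in\mathbb R^3$, $G_a'$ a real-valued function of $s>0$ of the form $G_a'(s)=a^{-2}G_1'(a^3s)$. Form factor: $\mathring\psi_1=\mathring\psi_1(|\mathbf x|)$ is a positive radial, twice continuously differentiable, square integrable solution of $-\nabla^2\mathring\psi_1+G_1'(|\mathring\psi_1|^2)\mathring\psi_1=0$ on $\mathbb R^3$, and $\mathring\psi_a(r)=a^{-3/2}\mathring\psi_1(a^{-1}r)$, which solves $-\nabla^2\mathring\psi_a+G_a'(|\mathring\psi_a|^2)\mathring\psi_a=0$. Notation correspondence: in coordinates $\mathbf y=\mathbf x-\mathbf r(t)$ one has $\varphi_0(t)=\varphi(t,\mathbf 0)$, $\mathbf g(t)=\nabla\varphi(t,\mathbf 0)$, $\mathbf A_0(t)=\mathbf A(t,\mathbf 0)$. *)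

theory Defs
  imports "HOL-Analysis.Analysis"
begin

text \<open>Continuous differentiability on a set that need not be open (a time interval \<open>I\<close>
  with endpoints, or \<open>I \<times> UNIV\<close>); at boundary points the derivative is the one relative
  to \<open>S\<close>.\<close>

definition C1_on :: "'a::real_normed_vector set \<Rightarrow> ('a \<Rightarrow> 'b::real_normed_vector) \<Rightarrow> bool" where
  "C1_on S f \<longleftrightarrow> (\<exists>D :: 'a \<Rightarrow> 'a \<Rightarrow>\<^sub>L 'b.
     (\<forall>z\<in>S. (f has_derivative blinfun_apply (D z)) (at z within S)) \<and> continuous_on S D)"

abbreviation time_deriv :: "real set \<Rightarrow> (real \<Rightarrow> 'b::real_normed_vector) \<Rightarrow> real \<Rightarrow> 'b" where
  "time_deriv I f t \<equiv> vector_derivative f (at t within I)"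

definition partial_deriv :: "3 \<Rightarrow> (real^3 \<Rightarrow> 'b::real_normed_vector) \<Rightarrow> real^3 \<Rightarrow> 'b" where
  "partial_deriv i f x = vector_derivative (\<lambda>h. f (x + h *\<^sub>R axis i 1)) (at 0)"

definition grad :: "(real^3 \<Rightarrow> real) \<Rightarrow> real^3 \<Rightarrow> real^3" where
  "grad f x = (\<chi> i. partial_deriv i f x)"

definition laplacian :: "(real^3 \<Rightarrow> 'b::real_normed_vector) \<Rightarrow> real^3 \<Rightarrow> 'b" where
  "laplacian f x = (\<Sum>i\<in>UNIV. partial_deriv i (partial_deriv i f) x)"

definition curl :: "(real^3 \<Rightarrow> real^3) \<Rightarrow> real^3 \<Rightarrow> real^3" where
  "curl F x = (let d = (\<lambda>i j. partial_deriv i (\<lambda>z. F z $ j) x)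
     in vector [d 2 3 - d 3 2, d 3 1 - d 1 3, d 1 2 - d 2 1])"

definition C2 :: "(real^3 \<Rightarrow> 'b::real_normed_vector) \<Rightarrow> bool" where
  "C2 f \<longleftrightarrow> C1_on UNIV f \<and> (\<forall>i. C1_on UNIV (partial_deriv i f))"

text \<open>A zero of at least third degree at the origin: \<open>f\<close> vanishes there together with all its
  partial derivatives of order less than three. It is used for twice continuously
  differentiable \<open>f\<close>, for which it follows from \<open>f y = O(norm y ^ 3)\<close>.\<close>

definition third_degree_zero :: "(real^3 \<Rightarrow> real) \<Rightarrow> bool" where
  "third_degree_zero f \<longleftrightarrow> f 0 = 0 \<and> (\<forall>i. partial_deriv i f 0 = 0) \<and>
     (\<forall>i j. partial_deriv i (partial_deriv j f) 0 = 0)"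

definition electric_field ::
    "real \<Rightarrow> real set \<Rightarrow> (real \<Rightarrow> real^3 \<Rightarrow> real) \<Rightarrow> (real \<Rightarrow> real^3 \<Rightarrow> real^3) \<Rightarrow> real \<Rightarrow> real^3 \<Rightarrow> real^3" where
  "electric_field c I \<phi> A t x = - grad (\<phi> t) x - (1 / c) *\<^sub>R time_deriv I (\<lambda>s. A s x) t"

definition magnetic_field :: "(real \<Rightarrow> real^3 \<Rightarrow> real^3) \<Rightarrow> real \<Rightarrow> real^3 \<Rightarrow> real^3" where
  "magnetic_field A t x = curl (A t) x"

definition cov_time_deriv ::
    "real \<Rightarrow> real \<Rightarrow> real set \<Rightarrow> (real \<Rightarrow> real^3 \<Rightarrow> real) \<Rightarrow> (real \<Rightarrow> real^3 \<Rightarrow> complex)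
      \<Rightarrow> real \<Rightarrow> real^3 \<Rightarrow> complex" where
  "cov_time_deriv q chi I \<phi> \<psi> t x =
     time_deriv I (\<lambda>s. \<psi> s x) t + \<i> * complex_of_real (q / chi * \<phi> t x) * \<psi> t x"

definition cov_partial ::
    "real \<Rightarrow> real \<Rightarrow> real \<Rightarrow> (real^3 \<Rightarrow> real^3) \<Rightarrow> 3 \<Rightarrow> (real^3 \<Rightarrow> complex) \<Rightarrow> real^3 \<Rightarrow> complex" where
  "cov_partial q chi c A i f x =
     partial_deriv i f x - \<i> * complex_of_real (q / (chi * c) * A x $ i) * f x"

definition cov_laplacian ::
    "real \<Rightarrow> real \<Rightarrow> real \<Rightarrow> (real^3 \<Rightarrow> real^3) \<Rightarrow> (real^3 \<Rightarrow> complex) \<Rightarrow> real^3 \<Rightarrow> complex" where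
  "cov_laplacian q chi c A f x =
     (\<Sum>i\<in>UNIV. cov_partial q chi c A i (cov_partial q chi c A i f) x)"

text \<open>In the following, \<open>G1\<close> stands for the derivative of the nonlinearity at size 1 and
  \<open>G_size G1 a\<close> for the one at size \<open>a\<close>; only their values at positive arguments matter.\<close>

definition G_size :: "(real \<Rightarrow> real) \<Rightarrow> real \<Rightarrow> real \<Rightarrow> real" where
  "G_size G1 a s = G1 (a ^ 3 * s) / a\<^sup>2"

definition form_factor :: "(real \<Rightarrow> real) \<Rightarrow> (real \<Rightarrow> real) \<Rightarrow> bool" where
  "form_factor G1 \<rho> \<longleftrightarrow>
     (\<forall>r\<ge>0. \<rho> r > 0) \<and>
     C2 (\<lambda>x. \<rho> (norm x)) \<and>
     integrable lborel (\<lambda>x::real^3. (\<rho> (norm x))\<^sup>2) \<and>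
     (\<forall>x. - laplacian (\<lambda>z. \<rho> (norm z)) x + G1 (\<bar>\<rho> (norm x)\<bar>\<^sup>2) * \<rho> (norm x) = 0)"

definition rescaled :: "(real \<Rightarrow> real) \<Rightarrow> real \<Rightarrow> real \<Rightarrow> real" where
  "rescaled \<rho> a r = a powr (- 3 / 2) * \<rho> (r / a)"

text \<open>Classical solutions on \<open>I\<close>: the derivatives occurring in the equation are required to
  exist, and the equation holds pointwise.\<close>

definition NLS_solution ::
    "real \<Rightarrow> real \<Rightarrow> real \<Rightarrow> real \<Rightarrow> (real \<Rightarrow> real) \<Rightarrow> real set \<Rightarrow> (real \<Rightarrow> real^3 \<Rightarrow> real)
      \<Rightarrow> (real \<Rightarrow> real^3 \<Rightarrow> real^3) \<Rightarrow> (real \<Rightarrow> real^3 \<Rightarrow> complex) \<Rightarrow> bool" where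
  "NLS_solution m chi c q G I \<phi> A \<psi> \<longleftrightarrow> (\<forall>t\<in>I.
     C2 (\<psi> t) \<and>
     (\<forall>x. (\<lambda>s. \<psi> s x) differentiable (at t within I) \<and>
          (\<forall>i. cov_partial q chi c (A t) i (\<psi> t) differentiable (at x)) \<and>
          \<i> * cov_time_deriv q chi I \<phi> \<psi> t x =
            complex_of_real (chi / (2 * m)) *
              (- cov_laplacian q chi c (A t) (\<psi> t) x
               + complex_of_real (G ((cmod (\<psi> t x))\<^sup>2)) * \<psi> t x)))"

end

theory Submission
  imports Defs
begin

text \<open>Write \<open>y = x - r(t)\<close>, \<open>K = q / (\<chi> c)\<close>, and \<open>R(y)\<close> for the rescaled form factor at \<open>|y|\<close>.
  As \<open>P\<^sub>3\<close> vanishes at \<open>y = 0\<close>, the line integral in the phase is \<open>K (P\<^sub>2 + P\<^sub>3)\<close>, whose gradient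
  cancels the gradient part of \<open>K A\<close>. Hence the covariant gradient of the phase, \<open>\<nabla>S - K A\<close>, is
  the affine field \<open>w = (m / \<chi>) v - K A_breve\<close> with \<open>A_breve\<close> linear and antisymmetric in \<open>y\<close>
  (lemma \<open>quadratic_phase\<close>). Such a field is divergence free, and \<open>A_breve\<close> is tangent to the
  spheres on which \<open>R\<close> is constant, so the covariant Laplacian of \<open>exp(iS) R\<close> is
  \<open>exp(iS) (\<Delta>R - |w|\<^sup>2 R + 2 i (m / \<chi>) v \<bullet> \<nabla>R)\<close> (lemma \<open>cov_laplacian_phase_radial\<close>).

  On the other side, the time derivative at fixed \<open>x\<close> contributes \<open>- exp(iS) v \<bullet> \<nabla>R\<close> from the motion
  of the amplitude, which is exactly the first order term above, and the amplitude equation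
  \<open>\<Delta>R = G_a'(R\<^sup>2) R\<close> (lemma \<open>rescaled_form_factor\<close>) takes care of \<open>\<Delta>R\<close> and the nonlinearity.
  What remains is the Hamilton--Jacobi equation
  \<open>\<partial>\<^sub>t S - v \<bullet> \<nabla>S + (q / \<chi>) \<phi> = - (\<chi> / (2 m)) |w|\<^sup>2\<close> (lemma \<open>hamilton_jacobi\<close>): its terms of order zero
  in \<open>y\<close> define \<open>s\<^sub>p\<close>, the terms linear in \<open>y\<close> are Newton's equation, and \<open>\<phi>\<^sub>2\<close> is chosen to balance
  all the others.

  Newton's equation turns into
  \<open>m v' = - q g - (q / c) A\<^sub>0' + (q / c) A\<^sub>1\<^sup>T v\<close> because \<open>P\<^sub>3\<close> does not act on the particle (lemma
  \<open>lorentz_force\<close>). The delicate term here is \<open>\<partial>\<^sub>t P\<^sub>3\<close>, about which nothing is assumed directly: it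
  exists since \<open>P\<^sub>3(t, y)\<close> is the integral of \<open>y \<bullet> \<nabla>P\<^sub>3(t, s y)\<close> over \<open>0 \<le> s \<le> 1\<close>, and the same formula
  shows that it has zero gradient at the origin.\<close>

section \<open>Partial derivatives and classes of differentiability\<close>

lemma partial_deriv_eq:
  assumes "(f has_derivative D) (at x)"
  shows "partial_deriv i f x = D (axis i 1)"
proof -
  have "((\<lambda>h::real. x + h *\<^sub>R axis i 1) has_derivative (\<lambda>h. h *\<^sub>R axis i 1)) (at 0)"
    by (auto intro!: derivative_eq_intros)
  moreover have "(f has_derivative D) (at (x + 0 *\<^sub>R axis i 1))"
    using assms by simp
  ultimately have "((\<lambda>h. f (x + h *\<^sub>R axis i 1)) has_derivative (\<lambda>h. D (h *\<^sub>R axis i 1))) (at 0)"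
    by (rule has_derivative_compose)
  moreover have "D (h *\<^sub>R axis i 1) = h *\<^sub>R D (axis i 1)" for h
    using has_derivative_bounded_linear[OF assms] by (simp add: linear_simps)
  ultimately show ?thesis
    unfolding partial_deriv_def
    by (intro vector_derivative_at) (simp add: has_vector_derivative_def)
qed

lemma has_derivative_partials:
  assumes "f differentiable (at x)"
  shows "(f has_derivative (\<lambda>h. \<Sum>i\<in>UNIV. h $ i *\<^sub>R partial_deriv i f x)) (at x)"
proof -
  obtain D where D: "(f has_derivative D) (at x)"
    using assms by (auto simp: differentiable_def)
  interpret D: bounded_linear D by (rule has_derivative_bounded_linear[OF D])
  have "D h = (\<Sum>i\<in>UNIV. h $ i *\<^sub>R partial_deriv i f x)" for h
  proof -
    have "D h = D (\<Sum>i\<in>UNIV. h $ i *\<^sub>R axis i 1)"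
      by (simp add: basis_expansion flip: scalar_mult_eq_scaleR)
    also have "\<dots> = (\<Sum>i\<in>UNIV. h $ i *\<^sub>R D (axis i 1))"
      by (simp add: D.sum D.scaleR)
    finally show ?thesis
      by (simp add: partial_deriv_eq[OF D])
  qed
  then have "D = (\<lambda>h. \<Sum>i\<in>UNIV. h $ i *\<^sub>R partial_deriv i f x)" ..
  then show ?thesis using D by simp
qed

lemma has_derivative_grad:
  assumes "f differentiable (at x)"
  shows "(f has_derivative (\<lambda>h. grad f x \<bullet> h)) (at x)"
  using has_derivative_partials[OF assms]
  by (simp add: grad_def inner_vec_def mult.commute)

lemma C1_on_UNIV_iff:
  fixes f :: "real^3 \<Rightarrow> 'b::real_normed_vector"
  shows "C1_on UNIV f \<longleftrightarrow>
    (\<forall>x. f differentiable (at x)) \<and> (\<forall>i. continuous_on UNIV (partial_deriv i f))"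
proof
  assume "C1_on UNIV f"
  then obtain D :: "real^3 \<Rightarrow> ((real^3) \<Rightarrow>\<^sub>L 'b)"
    where D: "\<And>z. (f has_derivative blinfun_apply (D z)) (at z)" and cont: "continuous_on UNIV D"
    by (auto simp: C1_on_def)
  have "partial_deriv i f = (\<lambda>x. blinfun_apply (D x) (axis i 1))" for i
    by (rule ext) (rule partial_deriv_eq[OF D])
  moreover have "continuous_on UNIV (\<lambda>x. blinfun_apply (D x) (axis i 1))" for i
    by (intro continuous_intros cont)
  ultimately show "(\<forall>x. f differentiable (at x)) \<and> (\<forall>i. continuous_on UNIV (partial_deriv i f))"
    using D by (auto simp: differentiable_def)
next
  assume *: "(\<forall>x. f differentiable (at x)) \<and> (\<forall>i. continuous_on UNIV (partial_deriv i f))"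
  define D where "D x = Blinfun (\<lambda>h. \<Sum>i\<in>UNIV. h $ i *\<^sub>R partial_deriv i f x)" for x
  have app: "blinfun_apply (D x) = (\<lambda>h. \<Sum>i\<in>UNIV. h $ i *\<^sub>R partial_deriv i f x)" for x
    unfolding D_def
    by (rule bounded_linear_Blinfun_apply)
      (rule has_derivative_bounded_linear[OF has_derivative_partials], use * in auto)
  have "continuous_on UNIV D"
    by (rule continuous_on_blinfun_componentwise) (auto simp: app intro!: continuous_intros simp: *)
  moreover have "(f has_derivative blinfun_apply (D z)) (at z)" for z
    unfolding app by (rule has_derivative_partials) (use * in auto)
  ultimately show "C1_on UNIV f"
    by (auto simp: C1_on_def)
qed

lemma C1_on_differentiable: "C1_on UNIV f \<Longrightarrow> f differentiable (at x)"
  for f :: "'a::real_normed_vector \<Rightarrow> 'b::real_normed_vector"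
  by (auto simp: C1_on_def differentiable_def)

lemma differentiable_bounded_linear:
  assumes "f differentiable (at x)" "bounded_linear h"
  shows "(\<lambda>x. h (f x)) differentiable (at x)"
  using assms bounded_linear.has_derivative unfolding differentiable_def by blast

lemma C1_on_imp_continuous_on: "C1_on S f \<Longrightarrow> continuous_on S f"
  by (auto simp: C1_on_def continuous_on_eq_continuous_within intro: has_derivative_continuous)

lemma C1_on_linear: "bounded_linear f \<Longrightarrow> C1_on S f"
  unfolding C1_on_def
  by (rule exI[of _ "\<lambda>_. Blinfun f"])
    (auto simp: bounded_linear_Blinfun_apply bounded_linear_imp_has_derivative)

lemma C1_on_const: "C1_on S (\<lambda>_. k)"
  unfolding C1_on_def by (rule exI[of _ "\<lambda>_. 0"]) (auto simp: zero_blinfun.rep_eq)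

lemma partial_deriv_add:
  "f differentiable (at x) \<Longrightarrow> g differentiable (at x) \<Longrightarrow>
    partial_deriv i (\<lambda>x. f x + g x) x = partial_deriv i f x + partial_deriv i g x"
  unfolding differentiable_def by (auto simp: partial_deriv_eq partial_deriv_eq[OF has_derivative_add])

lemma partial_deriv_mult:
  fixes f g :: "real^3 \<Rightarrow> 'b::real_normed_algebra"
  assumes "f differentiable (at x)" "g differentiable (at x)"
  shows "partial_deriv i (\<lambda>x. f x * g x) x = f x * partial_deriv i g x + partial_deriv i f x * g x"
  using assms unfolding differentiable_def
  by (auto simp: partial_deriv_eq partial_deriv_eq[OF has_derivative_mult])

lemma partial_deriv_bounded_linear:
  assumes "f differentiable (at x)" "bounded_linear h"
  shows "partial_deriv i (\<lambda>x. h (f x)) x = h (partial_deriv i f x)"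
  using assms unfolding differentiable_def
  by (auto simp: partial_deriv_eq partial_deriv_eq[OF bounded_linear.has_derivative])

lemma C1_on_add:
  fixes f g :: "real^3 \<Rightarrow> 'b::real_normed_vector"
  assumes "C1_on UNIV f" "C1_on UNIV g"
  shows "C1_on UNIV (\<lambda>x. f x + g x)"
proof -
  have "partial_deriv i (\<lambda>x. f x + g x) = (\<lambda>x. partial_deriv i f x + partial_deriv i g x)" for i
    using assms by (auto simp: partial_deriv_add C1_on_differentiable)
  then show ?thesis
    using assms by (auto simp: C1_on_UNIV_iff intro!: continuous_intros)
qed

lemma C1_on_mult:
  fixes f g :: "real^3 \<Rightarrow> 'b::real_normed_algebra"
  assumes "C1_on UNIV f" "C1_on UNIV g"
  shows "C1_on UNIV (\<lambda>x. f x * g x)"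
proof -
  have "partial_deriv i (\<lambda>x. f x * g x) = (\<lambda>x. f x * partial_deriv i g x + partial_deriv i f x * g x)" for i
    using assms by (auto simp: partial_deriv_mult C1_on_differentiable)
  moreover have "continuous_on UNIV (\<lambda>x. f x * partial_deriv i g x + partial_deriv i f x * g x)" for i
    using assms C1_on_imp_continuous_on[OF assms(1)] C1_on_imp_continuous_on[OF assms(2)]
    unfolding C1_on_UNIV_iff by (intro continuous_intros) simp_all
  ultimately show ?thesis
    using assms by (simp add: C1_on_UNIV_iff)
qed

lemma C1_on_bounded_linear:
  fixes f :: "real^3 \<Rightarrow> 'b::real_normed_vector" and h :: "'b \<Rightarrow> 'c::real_normed_vector"
  assumes "C1_on UNIV f" "bounded_linear h"
  shows "C1_on UNIV (\<lambda>x. h (f x))"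
proof -
  have "partial_deriv i (\<lambda>x. h (f x)) = (\<lambda>x. h (partial_deriv i f x))" for i
    using assms by (auto simp: partial_deriv_bounded_linear C1_on_differentiable)
  moreover have "(\<lambda>x. h (f x)) differentiable (at x)" for x
    by (rule differentiable_bounded_linear[OF C1_on_differentiable[OF assms(1)] assms(2)])
  ultimately show ?thesis
    using assms
    by (auto simp: C1_on_UNIV_iff intro!: bounded_linear.continuous_on[OF assms(2)])
qed

lemma partial_deriv_shift:
  "partial_deriv i (\<lambda>x. f (x - r)) = (\<lambda>x. partial_deriv i f (x - r))"
  by (rule ext) (simp add: partial_deriv_def algebra_simps)

lemma differentiable_shift:
  fixes f :: "'a::real_normed_vector \<Rightarrow> 'b::real_normed_vector"
  assumes "f differentiable (at (x - r))"
  shows "(\<lambda>x. f (x - r)) differentiable (at x)"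
proof -
  obtain D where "(f has_derivative D) (at (x - r))"
    using assms by (auto simp: differentiable_def)
  then have "((\<lambda>x. f (x - r)) has_derivative (\<lambda>h. D h)) (at x)"
    by (rule has_derivative_compose[rotated]) (auto intro!: derivative_eq_intros)
  then show ?thesis by (auto simp: differentiable_def)
qed

lemma C1_on_shift:
  fixes f :: "real^3 \<Rightarrow> 'b::real_normed_vector"
  assumes "C1_on UNIV f"
  shows "C1_on UNIV (\<lambda>x. f (x - r))"
proof -
  have "continuous_on UNIV (\<lambda>x. partial_deriv i f (x - r))" for i
    by (rule continuous_on_compose2[of UNIV "partial_deriv i f"])
      (use assms in \<open>auto simp: C1_on_UNIV_iff intro!: continuous_intros\<close>)
  then show ?thesis
    using assms by (simp add: C1_on_UNIV_iff partial_deriv_shift differentiable_shift)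
qed

lemma C2_shift: "C2 f \<Longrightarrow> C2 (\<lambda>x. f (x - r))"
  by (auto simp: C2_def partial_deriv_shift C1_on_shift)

lemma partial_deriv_dilation:
  fixes f :: "real^3 \<Rightarrow> real"
  assumes "\<And>x. f differentiable (at x)"
  shows "partial_deriv i (\<lambda>x. k * f (b *\<^sub>R x)) = (\<lambda>x. (k * b) * partial_deriv i f (b *\<^sub>R x))"
proof
  fix x
  have "((\<lambda>x. f (b *\<^sub>R x)) has_derivative (\<lambda>h. grad f (b *\<^sub>R x) \<bullet> (b *\<^sub>R h))) (at x)"
    by (rule has_derivative_compose[OF _ has_derivative_grad]) (auto intro!: derivative_eq_intros assms)
  then have "((\<lambda>x. k * f (b *\<^sub>R x)) has_derivative (\<lambda>h. k * (grad f (b *\<^sub>R x) \<bullet> (b *\<^sub>R h)))) (at x)"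
    by (auto intro!: derivative_eq_intros)
  then show "partial_deriv i (\<lambda>x. k * f (b *\<^sub>R x)) x = (k * b) * partial_deriv i f (b *\<^sub>R x)"
    by (simp add: partial_deriv_eq inner_axis grad_def)
qed

lemma C1_on_dilation:
  fixes f :: "real^3 \<Rightarrow> real"
  assumes "C1_on UNIV f"
  shows "C1_on UNIV (\<lambda>x. k * f (b *\<^sub>R x))"
proof -
  have "(\<lambda>x. k * f (b *\<^sub>R x)) differentiable (at x)" for x
  proof -
    have "((\<lambda>x. f (b *\<^sub>R x)) has_derivative (\<lambda>h. grad f (b *\<^sub>R x) \<bullet> (b *\<^sub>R h))) (at x)"
      by (rule has_derivative_compose[OF _ has_derivative_grad])
        (auto intro!: derivative_eq_intros C1_on_differentiable assms)
    then show ?thesis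
      by (auto simp: differentiable_def intro!: exI derivative_eq_intros)
  qed
  moreover have "continuous_on UNIV (partial_deriv i (\<lambda>x. k * f (b *\<^sub>R x)))" for i
  proof -
    have "continuous_on UNIV (\<lambda>x. partial_deriv i f (b *\<^sub>R x))"
      by (rule continuous_on_compose2[of UNIV "partial_deriv i f"])
        (use assms in \<open>auto simp: C1_on_UNIV_iff intro!: continuous_intros\<close>)
    then show ?thesis
      unfolding partial_deriv_dilation[OF C1_on_differentiable[OF assms]]
      by (intro continuous_intros)
  qed
  ultimately show ?thesis by (auto simp: C1_on_UNIV_iff)
qed

lemma C2_dilation:
  fixes f :: "real^3 \<Rightarrow> real"
  assumes "C2 f"
  shows "C2 (\<lambda>x. k * f (b *\<^sub>R x))"
    and "laplacian (\<lambda>x. k * f (b *\<^sub>R x)) x = k * b\<^sup>2 * laplacian f (b *\<^sub>R x)"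
proof -
  have f: "C1_on UNIV f" and pf: "\<And>i. C1_on UNIV (partial_deriv i f)"
    using assms by (auto simp: C2_def)
  note 1 = partial_deriv_dilation[OF C1_on_differentiable[OF f]]
  note 2 = partial_deriv_dilation[OF C1_on_differentiable[OF pf]]
  show "C2 (\<lambda>x. k * f (b *\<^sub>R x))"
    using f pf by (auto simp: C2_def 1 intro: C1_on_dilation)
  show "laplacian (\<lambda>x. k * f (b *\<^sub>R x)) x = k * b\<^sup>2 * laplacian f (b *\<^sub>R x)"
    unfolding laplacian_def 1 2 by (simp add: sum_distrib_left power2_eq_square mult.assoc)
qed

text \<open>Evenness in tangential directions replaces differentiating the norm, and so covers the
  origin as well.\<close>

lemma orthogonal_grad_radial:
  assumes R: "R differentiable (at x)" and rad: "\<And>y z. norm y = norm z \<Longrightarrow> R y = R z"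
    and orth: "x \<bullet> u = 0"
  shows "grad R x \<bullet> u = 0"
proof -
  have d: "((\<lambda>s. R (x + (k * s) *\<^sub>R u)) has_derivative (\<lambda>s. grad R x \<bullet> ((k * s) *\<^sub>R u))) (at 0)"
    for k :: real
  proof -
    have "((\<lambda>s. x + (k * s) *\<^sub>R u) has_derivative (\<lambda>s. (k * s) *\<^sub>R u)) (at 0)"
      by (auto intro!: derivative_eq_intros)
    moreover have "(R has_derivative (\<lambda>h. grad R x \<bullet> h)) (at (x + (k * 0) *\<^sub>R u))"
      using has_derivative_grad[OF R] by simp
    ultimately show ?thesis by (rule has_derivative_compose)
  qed
  \<comment> \<open>Reflection in the line spanned by \<open>x\<close> makes \<open>R\<close> an even function of \<open>s\<close>.\<close>
  have even: "R (x + (1 * s) *\<^sub>R u) = R (x + (-1 * s) *\<^sub>R u)" for s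
    using orth by (intro rad) (simp add: norm_eq_sqrt_inner inner_simps inner_commute[of u x])
  have "(\<lambda>s. grad R x \<bullet> ((1 * s) *\<^sub>R u)) = (\<lambda>s. grad R x \<bullet> ((-1 * s) *\<^sub>R u))"
    by (rule has_derivative_unique[OF d[of 1, unfolded even] d[of "-1"]])
  from fun_cong[OF this, of 1] show ?thesis by simp
qed

section \<open>Covariant derivatives and phase factors\<close>

lemma has_derivative_phase:
  fixes \<theta> :: "'a::real_normed_vector \<Rightarrow> real"
  assumes "(\<theta> has_derivative D) (at x within S)"
  shows "((\<lambda>x. exp (\<i> * complex_of_real (\<theta> x))) has_derivative
     (\<lambda>h. exp (\<i> * complex_of_real (\<theta> x)) * (\<i> * complex_of_real (D h)))) (at x within S)"
proof -
  have "((\<lambda>x. \<i> * complex_of_real (\<theta> x)) has_derivative (\<lambda>h. \<i> * complex_of_real (D h))) (at x within S)"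
    using assms by (auto intro!: derivative_eq_intros)
  from has_derivative_compose[OF this DERIV_exp[unfolded has_field_derivative_def]]
  show ?thesis by simp
qed

lemma differentiable_phase:
  fixes \<theta> :: "'a::real_normed_vector \<Rightarrow> real"
  assumes "\<theta> differentiable (at x within S)"
  shows "(\<lambda>x. exp (\<i> * complex_of_real (\<theta> x))) differentiable (at x within S)"
  using assms unfolding differentiable_def by (blast intro: has_derivative_phase)

lemma partial_deriv_phase:
  assumes "\<theta> differentiable (at x)"
  shows "partial_deriv i (\<lambda>x. exp (\<i> * complex_of_real (\<theta> x))) x =
    \<i> * complex_of_real (partial_deriv i \<theta> x) * exp (\<i> * complex_of_real (\<theta> x))"
proof -
  have "((\<lambda>x. exp (\<i> * complex_of_real (\<theta> x))) has_derivative
     (\<lambda>h. exp (\<i> * complex_of_real (\<theta> x)) * (\<i> * complex_of_real (grad \<theta> x \<bullet> h)))) (at x)"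
    by (rule has_derivative_phase[OF has_derivative_grad[OF assms]])
  from partial_deriv_eq[OF this] show ?thesis
    by (simp add: inner_axis grad_def)
qed

lemma C1_on_phase:
  fixes \<theta> :: "real^3 \<Rightarrow> real"
  assumes "C1_on UNIV \<theta>"
  shows "C1_on UNIV (\<lambda>x. exp (\<i> * complex_of_real (\<theta> x)))"
proof -
  have "partial_deriv i (\<lambda>x. exp (\<i> * complex_of_real (\<theta> x))) =
    (\<lambda>x. \<i> * complex_of_real (partial_deriv i \<theta> x) * exp (\<i> * complex_of_real (\<theta> x)))" for i
    by (intro ext partial_deriv_phase C1_on_differentiable assms)
  then show ?thesis
    using assms C1_on_imp_continuous_on[OF assms]
    by (auto simp: C1_on_UNIV_iff intro!: continuous_intros differentiable_phase)
qed

lemma cov_partial_shift: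
  "cov_partial q chi c A i (\<lambda>x. f (x - r)) =
    (\<lambda>x. cov_partial q chi c (\<lambda>y. A (y + r)) i f (x - r))"
  by (auto simp: cov_partial_def partial_deriv_shift)

lemma cov_laplacian_shift:
  "cov_laplacian q chi c A (\<lambda>x. f (x - r)) x = cov_laplacian q chi c (\<lambda>y. A (y + r)) f (x - r)"
  by (simp add: cov_laplacian_def cov_partial_shift)

lemma cov_partial_phase:
  assumes "\<theta> differentiable (at x)" "u differentiable (at x)"
  shows "cov_partial q chi c A i (\<lambda>x. exp (\<i> * complex_of_real (\<theta> x)) * u x) x =
    exp (\<i> * complex_of_real (\<theta> x)) *
      (partial_deriv i u x
        + \<i> * complex_of_real (partial_deriv i \<theta> x - q / (chi * c) * A x $ i) * u x)"
  using assms
  by (simp add: cov_partial_def partial_deriv_mult differentiable_phase partial_deriv_phase algebra_simps)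

lemma antisymmetric_matrix:
  fixes M :: "real^3^3"
  assumes "transpose M = - M"
  shows "M $ i $ i = 0" "y \<bullet> (M *v y) = 0"
proof -
  have M: "M $ i $ j = - (M $ j $ i)" for i j
    using arg_cong[OF assms, of "\<lambda>N. N $ j $ i"] by (simp add: transpose_def)
  show d: "M $ i $ i = 0" for i using M[of i i] by simp
  show "y \<bullet> (M *v y) = 0"
    using M[of 1 2] M[of 1 3] M[of 2 3] d
    by (simp add: inner_vec_def matrix_vector_mult_def sum_3 algebra_simps)
qed

text \<open>If the covariant gradient \<open>\<nabla>\<theta> - (q / (\<chi> c)) A\<close> of the phase is an affine field \<open>w = p + M y\<close>
  with antisymmetric \<open>M\<close>, then \<open>w\<close> has divergence zero, and \<open>M y\<close> is tangent to the spheres on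
  which the radial amplitude \<open>R\<close> is constant.\<close>

lemma cov_laplacian_phase_radial:
  fixes \<theta> R :: "real^3 \<Rightarrow> real" and M :: "real^3^3"
  assumes \<theta>: "\<And>y. \<theta> differentiable (at y)"
    and w: "\<And>y i. partial_deriv i \<theta> y - q / (chi * c) * A y $ i = (p + M *v y) $ i"
    and M: "transpose M = - M"
    and R: "C2 R" and rad: "\<And>y z. norm y = norm z \<Longrightarrow> R y = R z"
  defines "F \<equiv> \<lambda>y. exp (\<i> * complex_of_real (\<theta> y)) * complex_of_real (R y)"
  shows "cov_partial q chi c A i F differentiable (at y)"
    and "cov_laplacian q chi c A F y = exp (\<i> * complex_of_real (\<theta> y)) *
      (complex_of_real (laplacian R y - (p + M *v y) \<bullet> (p + M *v y) * R y)
        + 2 * \<i> * complex_of_real (p \<bullet> grad R y))"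
proof -
  let ?e = "\<lambda>y. exp (\<i> * complex_of_real (\<theta> y))"
  have R1: "R differentiable (at y)" and R2: "partial_deriv i R differentiable (at y)" for i y
    using R by (auto simp: C2_def C1_on_differentiable)
  have cR: "(\<lambda>y. complex_of_real (f y)) differentiable (at y)" if "f differentiable (at y)"
    for f :: "real^3 \<Rightarrow> real" and y
    using differentiable_bounded_linear[OF that bounded_linear_of_real] .
  have pcR: "partial_deriv i (\<lambda>y. complex_of_real (f y)) y = complex_of_real (partial_deriv i f y)"
    if "f differentiable (at y)" for f :: "real^3 \<Rightarrow> real" and i y
    by (rule partial_deriv_bounded_linear[OF that bounded_linear_of_real])
  have wd: "((\<lambda>y. (p + M *v y) $ i) has_derivative (\<lambda>h. (M *v h) $ i)) (at y)" for i y
  proof -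
    have "((\<lambda>y. M *v y) has_derivative (\<lambda>h. M *v h)) (at y)"
      by (rule bounded_linear_imp_has_derivative) (rule matrix_vector_mul_bounded_linear)
    then have "((\<lambda>y. p + M *v y) has_derivative (\<lambda>h. M *v h)) (at y)"
      by (auto intro!: derivative_eq_intros)
    then show ?thesis by (rule bounded_linear.has_derivative[OF bounded_linear_vec_nth])
  qed
  then have w1: "(\<lambda>y. (p + M *v y) $ i) differentiable (at y)" for i y
    by (auto simp: differentiable_def)
  have wp: "partial_deriv i (\<lambda>y. (p + M *v y) $ i) y = 0" for i y
    using partial_deriv_eq[OF wd, of i i y] antisymmetric_matrix(1)[OF M, of i]
    by (simp add: matrix_vector_mult_basis column_def)
  define u where "u i y = complex_of_real (partial_deriv i R y)
     + \<i> * (complex_of_real ((p + M *v y) $ i) * complex_of_real (R y))" for i y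
  have first: "cov_partial q chi c A i F = (\<lambda>y. ?e y * u i y)" for i
    unfolding F_def u_def
    by (rule ext) (simp only: cov_partial_phase[OF \<theta> cR[OF R1]] w pcR[OF R1] mult.assoc)
  have u1: "u i differentiable (at y)" for i y
    unfolding u_def
    by (intro derivative_intros differentiable_add differentiable_mult cR R2 R1 w1 differentiable_const)
  show "cov_partial q chi c A i F differentiable (at y)"
    unfolding first by (intro differentiable_mult differentiable_phase \<theta> u1)
  have pu: "partial_deriv i (u i) y = complex_of_real (partial_deriv i (partial_deriv i R) y)
     + \<i> * (complex_of_real ((p + M *v y) $ i) * complex_of_real (partial_deriv i R y))" for i y
  proof -
    have a: "partial_deriv i (\<lambda>y. complex_of_real ((p + M *v y) $ i) * complex_of_real (R y)) y =
       complex_of_real ((p + M *v y) $ i) * complex_of_real (partial_deriv i R y)"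
      by (subst partial_deriv_mult) (auto simp only: cR w1 R1 pcR[OF w1] pcR[OF R1] wp, auto)
    have b: "(\<lambda>y. complex_of_real ((p + M *v y) $ i) * complex_of_real (R y)) differentiable (at y)"
      by (intro differentiable_mult cR w1 R1)
    have c: "partial_deriv i (\<lambda>y. \<i> * (complex_of_real ((p + M *v y) $ i) * complex_of_real (R y))) y =
       \<i> * (complex_of_real ((p + M *v y) $ i) * complex_of_real (partial_deriv i R y))"
      unfolding a[symmetric] by (rule partial_deriv_bounded_linear[OF b bounded_linear_mult_right])
    show ?thesis
      unfolding u_def using b
      by (subst partial_deriv_add) (auto simp only: cR R2 pcR[OF R2] c intro!: differentiable_mult differentiable_const)
  qed
  have second: "cov_partial q chi c A i (cov_partial q chi c A i F) y = ?e y *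
      (complex_of_real (partial_deriv i (partial_deriv i R) y - ((p + M *v y) $ i)\<^sup>2 * R y)
        + 2 * \<i> * complex_of_real ((p + M *v y) $ i * grad R y $ i))" for i
    unfolding first cov_partial_phase[OF \<theta> u1] w pu
    by (simp add: u_def grad_def algebra_simps power2_eq_square)
  have "cov_laplacian q chi c A F y = ?e y *
      (complex_of_real (laplacian R y - (p + M *v y) \<bullet> (p + M *v y) * R y)
        + 2 * \<i> * complex_of_real ((p + M *v y) \<bullet> grad R y))"
    unfolding cov_laplacian_def second laplacian_def inner_vec_def
    by (simp add: sum_3 algebra_simps power2_eq_square)
  moreover have "(p + M *v y) \<bullet> grad R y = p \<bullet> grad R y"
    using orthogonal_grad_radial[OF R1 rad antisymmetric_matrix(2)[OF M], of y]
    by (simp add: inner_add_left inner_commute[of _ "grad R y"] inner_add_right)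
  ultimately show "cov_laplacian q chi c A F y = ?e y *
      (complex_of_real (laplacian R y - (p + M *v y) \<bullet> (p + M *v y) * R y)
        + 2 * \<i> * complex_of_real (p \<bullet> grad R y))"
    by simp
qed

lemma C2_phase:
  fixes \<theta> R :: "real^3 \<Rightarrow> real"
  assumes \<theta>: "C2 \<theta>" and R: "C2 R"
  shows "C2 (\<lambda>y. exp (\<i> * complex_of_real (\<theta> y)) * complex_of_real (R y))"
proof -
  let ?e = "\<lambda>y. exp (\<i> * complex_of_real (\<theta> y))"
  note C1 = C1_on_mult C1_on_add C1_on_const C1_on_bounded_linear[OF _ bounded_linear_of_real] C1_on_phase
  have \<theta>1: "C1_on UNIV \<theta>" "\<And>i. C1_on UNIV (partial_deriv i \<theta>)"
    and R1: "C1_on UNIV R" "\<And>i. C1_on UNIV (partial_deriv i R)"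
    using \<theta> R by (auto simp: C2_def)
  have "partial_deriv i (\<lambda>y. ?e y * complex_of_real (R y)) = (\<lambda>y. ?e y * complex_of_real (partial_deriv i R y)
      + \<i> * complex_of_real (partial_deriv i \<theta> y) * ?e y * complex_of_real (R y))" for i
  proof
    fix y
    have d: "\<theta> differentiable (at y)" "R differentiable (at y)"
      using \<theta>1(1) R1(1) by (auto intro: C1_on_differentiable)
    show "partial_deriv i (\<lambda>y. ?e y * complex_of_real (R y)) y = ?e y * complex_of_real (partial_deriv i R y)
      + \<i> * complex_of_real (partial_deriv i \<theta> y) * ?e y * complex_of_real (R y)"
      using differentiable_phase[OF d(1)] differentiable_bounded_linear[OF d(2), of complex_of_real] d
      by (simp only: bounded_linear_of_real simp_thms partial_deriv_mult partial_deriv_phase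
          partial_deriv_bounded_linear[OF d(2) bounded_linear_of_real])
  qed
  then show ?thesis
    unfolding C2_def by (auto intro!: C1 \<theta>1 R1)
qed

section \<open>Calculus on a time interval\<close>

lemma at_within_interval_neq_bot:
  fixes I :: "real set"
  assumes "is_interval I" "t0 \<in> I" "I \<noteq> {t0}" "t \<in> I"
  shows "at t within I \<noteq> bot"
proof -
  have "t islimpt I"
    using assms by (intro connected_imp_perfect) (auto simp: is_interval_connected)
  then show ?thesis by (simp add: trivial_limit_within)
qed

lemma C1_on_has_vector_derivative:
  assumes "C1_on I f" "t \<in> I"
  shows "(f has_vector_derivative time_deriv I f t) (at t within I)"
  using assms by (intro vector_derivative_works[THEN iffD1]) (auto simp: C1_on_def differentiable_def)

text \<open>The fundamental theorem of calculus is available on compact intervals. A point of an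
  arbitrary interval has the same one-sided or two-sided neighbourhoods in a compact subinterval,
  which can be chosen to contain a second given point.\<close>

lemma interval_germ_compact:
  fixes I :: "real set"
  assumes I: "is_interval I" and t: "t \<in> I" "t0 \<in> I"
  obtains a b where "a \<le> t" "t \<le> b" "a \<le> t0" "t0 \<le> b" "{a..b} \<subseteq> I"
    "at t within {a..b} = at t within I"
proof -
  have "\<exists>a\<in>I. a \<le> t \<and> a \<le> t0 \<and> ((\<exists>s\<in>I. s < t) \<longrightarrow> a < t)"
  proof (cases "\<exists>s\<in>I. s < t")
    case True
    then obtain s where "s \<in> I" "s < t" by blast
    then show ?thesis using t by (intro bexI[of _ "min t0 s"]) (auto simp: min_def)
  next
    case False
    then show ?thesis using t by (intro bexI[of _ t]) (auto simp: not_less)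
  qed
  then obtain a where a: "a \<in> I" "a \<le> t" "a \<le> t0" "(\<exists>s\<in>I. s < t) \<longrightarrow> a < t" by (elim bexE conjE)
  have "\<exists>b\<in>I. t \<le> b \<and> t0 \<le> b \<and> ((\<exists>s\<in>I. t < s) \<longrightarrow> t < b)"
  proof (cases "\<exists>s\<in>I. t < s")
    case True
    then obtain s where "s \<in> I" "t < s" by blast
    then show ?thesis using t by (intro bexI[of _ "max t0 s"]) (auto simp: max_def)
  next
    case False
    then show ?thesis using t by (intro bexI[of _ t]) (auto simp: not_less)
  qed
  then obtain b where b: "b \<in> I" "t \<le> b" "t0 \<le> b" "(\<exists>s\<in>I. t < s) \<longrightarrow> t < b" by (elim bexE conjE)
  have sub: "{a..b} \<subseteq> I"
  proof
    fix s assume "s \<in> {a..b}"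
    then show "s \<in> I" using mem_is_interval_1_I[OF I a(1) b(1), of s] by simp
  qed
  define l where "l = (if a < t then a else t - 1)"
  define u where "u = (if t < b then b else t + 1)"
  have "{a..b} \<inter> {l<..<u} - {t} = I \<inter> {l<..<u} - {t}"
  proof
    show "{a..b} \<inter> {l<..<u} - {t} \<subseteq> I \<inter> {l<..<u} - {t}" using sub by blast
    show "I \<inter> {l<..<u} - {t} \<subseteq> {a..b} \<inter> {l<..<u} - {t}"
    proof
      fix s assume s: "s \<in> I \<inter> {l<..<u} - {t}"
      then consider "s < t" | "t < s" by fastforce
      then show "s \<in> {a..b} \<inter> {l<..<u} - {t}"
      proof cases
        case 1
        with s a(4) have "a < t" by auto
        with 1 s b(2) show ?thesis by (auto simp: l_def)
      next
        case 2
        with s b(4) have "t < b" by auto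
        with 2 s a(2) show ?thesis by (auto simp: u_def)
      qed
    qed
  qed
  then have "at t within {a..b} = at t within I"
    by (rule at_within_nhd[rotated 2]) (auto simp: l_def u_def)
  with that a b sub show ?thesis by blast
qed

lemma LBINT_has_vector_derivative_within_interval:
  fixes f :: "real \<Rightarrow> 'a::euclidean_space" and t0 t :: real
  assumes "is_interval I" "t0 \<in> I" "t \<in> I" "continuous_on I f"
  shows "((\<lambda>u. LBINT s=t0..u. f s) has_vector_derivative f t) (at t within I)"
proof -
  obtain a b where ab: "a \<le> t" "t \<le> b" "a \<le> t0" "t0 \<le> b" "{a..b} \<subseteq> I"
    and eq: "at t within {a..b} = at t within I"
    using interval_germ_compact assms(1-3) by metis
  have "((\<lambda>u. LBINT s=t0..u. f s) has_vector_derivative f t) (at t within {a..b})"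
    using ab continuous_on_subset[OF assms(4)] by (intro interval_integral_FTC2) auto
  then show ?thesis by (simp add: eq)
qed

section \<open>Time-dependent potentials that vanish to third order\<close>

text \<open>The gradient of the family \<open>P\<close> is continuously differentiable on space-time, \<open>D\<close> being its
  derivative. Time derivatives at end points of \<open>I\<close> are one-sided.\<close>

locale third_order_potential =
  fixes I :: "real set" and P :: "real \<Rightarrow> real^3 \<Rightarrow> real"
    and D :: "real \<times> (real^3) \<Rightarrow> (real \<times> (real^3)) \<Rightarrow>\<^sub>L (real^3)"
  assumes convex: "convex I"
    and nontrivial: "\<And>t. t \<in> I \<Longrightarrow> at t within I \<noteq> bot"
    and diff: "\<And>t y. t \<in> I \<Longrightarrow> P t differentiable (at y)"
    and grad_D: "\<And>z. z \<in> I \<times> UNIV \<Longrightarrow>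
      ((\<lambda>(t, y). grad (P t) y) has_derivative blinfun_apply (D z)) (at z within I \<times> UNIV)"
    and cont_D: "continuous_on (I \<times> UNIV) D"
    and zero: "\<And>t. t \<in> I \<Longrightarrow> third_degree_zero (P t)"
begin

text \<open>\<open>grad_t t y\<close> is the time derivative of the gradient at the fixed point \<open>y\<close>, and
  \<open>pot_t t y\<close> that of the potential itself, recovered from \<open>grad_t\<close> by integration along
  the segment from \<open>0\<close> to \<open>y\<close>.\<close>

definition grad_t :: "real \<Rightarrow> real^3 \<Rightarrow> real^3" where
  "grad_t t y = D (t, y) (1, 0)"

definition pot_t :: "real \<Rightarrow> real^3 \<Rightarrow> real" where
  "pot_t t y = integral {0..1} (\<lambda>s. y \<bullet> grad_t t (s *\<^sub>R y))"

lemma grad_along_curve: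
  assumes t: "t \<in> I" and w: "(w has_vector_derivative w') (at t within I)"
  shows "((\<lambda>s. grad (P s) (w s)) has_vector_derivative grad_t t (w t) + D (t, w t) (0, w')) (at t within I)"
proof -
  have "((\<lambda>s. (s, w s)) has_derivative (\<lambda>h. (h, h *\<^sub>R w'))) (at t within I)"
    using w unfolding has_vector_derivative_def by (auto intro!: derivative_eq_intros)
  moreover have "((\<lambda>(t, y). grad (P t) y) has_derivative blinfun_apply (D (t, w t)))
      (at (t, w t) within (\<lambda>s. (s, w s)) ` I)"
    by (rule has_derivative_subset[OF grad_D]) (use t in auto)
  ultimately have "((\<lambda>s. (\<lambda>(t, y). grad (P t) y) (s, w s)) has_derivative (\<lambda>h. D (t, w t) (h, h *\<^sub>R w'))) (at t within I)"
    by (rule has_derivative_in_compose)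
  moreover have "blinfun_apply (D (t, w t)) (h, h *\<^sub>R w') = h *\<^sub>R (grad_t t (w t) + D (t, w t) (0, w'))" for h
  proof -
    have "(h, h *\<^sub>R w') = h *\<^sub>R ((1, 0) + (0, w'))" by simp
    then show ?thesis
      unfolding grad_t_def by (simp only: blinfun.scaleR_right blinfun.add_right)
  qed
  ultimately show ?thesis by (simp add: has_vector_derivative_def)
qed

lemma grad_has_time_derivative:
  assumes "t \<in> I"
  shows "((\<lambda>s. grad (P s) y) has_vector_derivative grad_t t y) (at t within I)"
  using grad_along_curve[OF assms has_vector_derivative_const, of y]
  by (simp flip: zero_prod_def)

lemma grad_has_space_derivative:
  assumes t: "t \<in> I"
  shows "(grad (P t) has_derivative (\<lambda>h. D (t, y) (0, h))) (at y)"
proof -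
  have "((\<lambda>y. (t, y)) has_derivative (\<lambda>h. (0, h))) (at y)"
    by (auto intro!: derivative_eq_intros)
  moreover have "((\<lambda>(t, y). grad (P t) y) has_derivative blinfun_apply (D (t, y)))
      (at (t, y) within range (\<lambda>y. (t, y)))"
    by (rule has_derivative_subset[OF grad_D]) (use t in auto)
  ultimately have "((\<lambda>y. (\<lambda>(t, y). grad (P t) y) (t, y)) has_derivative (\<lambda>h. D (t, y) (0, h))) (at y)"
    by (rule has_derivative_in_compose)
  then show ?thesis by simp
qed

lemma continuous_on_grad: "continuous_on (I \<times> UNIV) (\<lambda>(t, y). grad (P t) y)"
  using grad_D by (auto simp: continuous_on_eq_continuous_within intro!: has_derivative_continuous)

lemma continuous_on_grad_t: "continuous_on (I \<times> UNIV) (\<lambda>(t, y). grad_t t y)"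
  unfolding grad_t_def split_beta by (simp add: continuous_intros cont_D)

lemma C2_potential:
  assumes t: "t \<in> I"
  shows "C2 (P t)"
proof -
  have g: "partial_deriv i (P t) = (\<lambda>y. grad (P t) y $ i)" for i
    by (simp add: grad_def)
  have "continuous_on UNIV (\<lambda>y. D (t, y))"
    by (rule continuous_on_compose2[OF cont_D]) (use t in \<open>auto intro!: continuous_intros\<close>)
  then have "continuous_on UNIV (partial_deriv j (grad (P t)))" for j
    unfolding partial_deriv_eq[OF grad_has_space_derivative[OF t]]
    by (intro continuous_intros)
  then have "C1_on UNIV (grad (P t))"
    using grad_has_space_derivative[OF t] by (auto simp: C1_on_UNIV_iff differentiable_def)
  then have "C1_on UNIV (partial_deriv i (P t))" for i
    unfolding g by (rule C1_on_bounded_linear[OF _ bounded_linear_vec_nth])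
  then show ?thesis
    using diff[OF t] by (auto simp: C2_def C1_on_UNIV_iff intro: C1_on_imp_continuous_on)
qed

lemma segment_has_vector_derivative:
  assumes t: "t \<in> I"
  shows "((\<lambda>s. P t (s *\<^sub>R y)) has_vector_derivative y \<bullet> grad (P t) (s *\<^sub>R y)) (at s within S)"
proof -
  have "((\<lambda>s. s *\<^sub>R y) has_derivative (\<lambda>h. h *\<^sub>R y)) (at s within S)"
    by (auto intro!: derivative_eq_intros)
  from has_derivative_compose[OF this has_derivative_grad[OF diff[OF t]]]
  show ?thesis by (simp add: has_vector_derivative_def inner_commute)
qed

lemma continuous_on_segment:
  assumes t: "t \<in> I"
  shows "continuous_on S (\<lambda>s. y \<bullet> grad (P t) (s *\<^sub>R y))"
proof -
  have "continuous_on S (\<lambda>s. (\<lambda>(t, y). grad (P t) y) (t, s *\<^sub>R y))"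
    by (rule continuous_on_compose2[OF continuous_on_grad]) (use t in \<open>auto intro!: continuous_intros\<close>)
  then show ?thesis by (auto intro!: continuous_intros)
qed

lemma potential_zero [simp]: "t \<in> I \<Longrightarrow> P t 0 = 0" "t \<in> I \<Longrightarrow> grad (P t) 0 = 0"
  using zero[of t] by (auto simp: third_degree_zero_def grad_def vec_eq_iff)

lemma potential_eq_integral:
  assumes t: "t \<in> I"
  shows "P t y = integral {0..1} (\<lambda>s. y \<bullet> grad (P t) (s *\<^sub>R y))"
proof -
  have "((\<lambda>s. y \<bullet> grad (P t) (s *\<^sub>R y)) has_integral (P t (1 *\<^sub>R y) - P t (0 *\<^sub>R y))) {0..1}"
    by (intro fundamental_theorem_of_calculus segment_has_vector_derivative t) simp
  then show ?thesis using t by (simp add: integral_unique)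
qed

lemma potential_has_time_derivative:
  assumes t: "t \<in> I"
  shows "((\<lambda>s. P s y) has_vector_derivative pot_t t y) (at t within I)"
proof -
  have "((\<lambda>x. integral (cbox 0 1) (\<lambda>s. y \<bullet> grad (P x) (s *\<^sub>R y))) has_vector_derivative
      integral (cbox 0 1) (\<lambda>s. y \<bullet> grad_t t (s *\<^sub>R y))) (at t within I)"
  proof (rule leibniz_rule_vector_derivative[OF _ _ _ t convex])
    show "((\<lambda>x. y \<bullet> grad (P x) (s *\<^sub>R y)) has_vector_derivative y \<bullet> grad_t x (s *\<^sub>R y)) (at x within I)"
      if "x \<in> I" for x s
      by (rule bounded_linear.has_vector_derivative[OF bounded_linear_inner_right
            grad_has_time_derivative[OF that]])
    show "(\<lambda>s. y \<bullet> grad (P x) (s *\<^sub>R y)) integrable_on cbox 0 1" if "x \<in> I" for x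
      by (intro integrable_continuous continuous_on_segment that)
    have "continuous_on (I \<times> cbox 0 1) (\<lambda>z. (\<lambda>(t, y). grad_t t y) (fst z, snd z *\<^sub>R y))"
      by (rule continuous_on_compose2[OF continuous_on_grad_t]) (auto intro!: continuous_intros)
    then show "continuous_on (I \<times> cbox 0 1) (\<lambda>(x, s). y \<bullet> grad_t x (s *\<^sub>R y))"
      by (auto simp: split_beta intro!: continuous_intros)
  qed
  note this[unfolded cbox_interval, folded pot_t_def]
  then show ?thesis
    by (rule has_vector_derivative_transform[OF t, rotated]) (auto simp: potential_eq_integral)
qed

text \<open>The total differential of \<open>P\<close> on space-time exists because the spatial gradient is jointly
  continuous; the partial time derivative is needed only at one point.\<close>

lemma potential_along_curve:
  assumes t: "t \<in> I" and w: "(w has_vector_derivative w') (at t within I)"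
  shows "((\<lambda>s. P s (w s)) has_vector_derivative pot_t t (w t) + w' \<bullet> grad (P t) (w t)) (at t within I)"
proof -
  have 1: "((\<lambda>(s, y). P s y) has_derivative
      (\<lambda>(\<tau>, h). \<tau> *\<^sub>R pot_t t (w t) + blinfun_inner_right (grad (P t) (w t)) h)) (at (t, w t) within I \<times> UNIV)"
  proof (rule has_derivative_partialsI[where fy = "\<lambda>s y. blinfun_inner_right (grad (P s) y)"])
    show "((\<lambda>x. P x (w t)) has_derivative (\<lambda>\<tau>. \<tau> *\<^sub>R pot_t t (w t))) (at t within I)"
      using potential_has_time_derivative[OF t] by (simp add: has_vector_derivative_def)
    show "(P x has_derivative blinfun_apply (blinfun_inner_right (grad (P x) y))) (at y within UNIV)"
      if "x \<in> I" for x y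
      using has_derivative_grad[OF diff[OF that]] by simp
    have "continuous_on (I \<times> UNIV) (\<lambda>z. blinfun_inner_right ((\<lambda>(s, y). grad (P s) y) z))"
      by (rule bounded_linear.continuous_on[OF bounded_linear_blinfun_inner_right continuous_on_grad])
    then show "continuous (at (t, w t) within I \<times> UNIV) (\<lambda>(s, y). blinfun_inner_right (grad (P s) y))"
      using t by (auto simp: continuous_on_eq_continuous_within case_prod_beta')
  qed auto
  have 2: "((\<lambda>s. (s, w s)) has_derivative (\<lambda>h. (h, h *\<^sub>R w'))) (at t within I)"
    using w unfolding has_vector_derivative_def by (auto intro!: derivative_eq_intros)
  from 1 have "((\<lambda>(s, y). P s y) has_derivative
      (\<lambda>(\<tau>, h). \<tau> *\<^sub>R pot_t t (w t) + blinfun_inner_right (grad (P t) (w t)) h))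
      (at (t, w t) within (\<lambda>s. (s, w s)) ` I)"
    by (rule has_derivative_subset) auto
  from has_derivative_in_compose[OF 2 this] show ?thesis
    by (simp add: has_vector_derivative_def inner_commute algebra_simps)
qed

lemma grad_t_zero: "t \<in> I \<Longrightarrow> grad_t t 0 = 0"
proof -
  assume t: "t \<in> I"
  have "((\<lambda>s. 0) has_vector_derivative grad_t t 0) (at t within I)"
    by (rule has_vector_derivative_transform[OF t _ grad_has_time_derivative[OF t, of 0]]) simp
  from vector_derivative_unique_within[OF nontrivial[OF t] this has_vector_derivative_const]
  show ?thesis .
qed

lemma hessian_zero: "t \<in> I \<Longrightarrow> D (t, 0) (0, h) = 0"
proof -
  assume t: "t \<in> I"
  have "D (t, 0) (0, axis i 1) $ j = 0" for i j
  proof -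
    have "((\<lambda>y. grad (P t) y $ j) has_derivative (\<lambda>h. D (t, 0) (0, h) $ j)) (at 0)"
      by (rule bounded_linear.has_derivative[OF bounded_linear_vec_nth grad_has_space_derivative[OF t]])
    from partial_deriv_eq[OF this, of i]
    have "D (t, 0) (0, axis i 1) $ j = partial_deriv i (partial_deriv j (P t)) 0"
      by (simp add: grad_def)
    then show ?thesis using zero[OF t] by (simp add: third_degree_zero_def)
  qed
  then have "D (t, 0) (0, axis i 1) = 0" for i by (simp add: vec_eq_iff)
  moreover have "D (t, 0) (0, h) = (\<Sum>i\<in>UNIV. h $ i *\<^sub>R D (t, 0) (0, axis i 1))"
  proof -
    have "(grad (P t) has_derivative (\<lambda>h. D (t, 0) (0, h))) (at 0)"
      by (rule grad_has_space_derivative[OF t])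
    moreover from this have "(grad (P t) has_derivative
        (\<lambda>h. \<Sum>i\<in>UNIV. h $ i *\<^sub>R partial_deriv i (grad (P t)) 0)) (at 0)"
      by (intro has_derivative_partials) (auto simp: differentiable_def)
    ultimately have "(\<lambda>h. D (t, 0) (0, h)) = (\<lambda>h. \<Sum>i\<in>UNIV. h $ i *\<^sub>R partial_deriv i (grad (P t)) 0)"
      by (rule has_derivative_unique)
    from fun_cong[OF this, of h] show ?thesis
      by (simp add: partial_deriv_eq[OF grad_has_space_derivative[OF t]])
  qed
  ultimately show ?thesis by simp
qed

text \<open>At the origin no interchange of the time and space derivatives of \<open>P\<close> is needed: on a line
  through it in direction \<open>e\<close>, \<open>pot_t t (h e) = h W(h)\<close> with \<open>W\<close> continuous and \<open>W(0) = 0\<close>.\<close>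

lemma pot_t_axis_derivative:
  assumes t: "t \<in> I"
  shows "((\<lambda>h. pot_t t (h *\<^sub>R axis i 1)) has_real_derivative 0) (at 0)"
  unfolding CARAT_DERIV
proof (intro exI conjI allI)
  define W where "W h = integral (cbox 0 1) (\<lambda>s. axis i 1 \<bullet> grad_t t (s *\<^sub>R h *\<^sub>R axis i (1::real)))" for h
  show "pot_t t (h *\<^sub>R axis i 1) - pot_t t (0 *\<^sub>R axis i 1) = W h * (h - 0)" for h
    by (simp add: pot_t_def W_def)
  have "continuous_on (UNIV \<times> cbox 0 1)
      (\<lambda>z::real \<times> real. (\<lambda>(t, y). grad_t t y) (t, snd z *\<^sub>R fst z *\<^sub>R axis i (1::real)))"
    by (rule continuous_on_compose2[OF continuous_on_grad_t]) (use t in \<open>auto intro!: continuous_intros\<close>)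
  then have "continuous_on UNIV W"
    unfolding W_def
    by (intro integral_continuous_on_param) (auto simp: split_beta intro!: continuous_intros)
  then show "isCont W 0" by (simp add: continuous_on_eq_continuous_at)
  show "W 0 = 0" using grad_t_zero[OF t] by (simp add: W_def)
qed

end

section \<open>The electromagnetic force on the moving point\<close>

lemma bounded_bilinear_matrix_vector_mult:
  "bounded_bilinear ((*v) :: real^'n^'m \<Rightarrow> real^'n \<Rightarrow> real^'m)"
proof -
  have "bilinear ((*v) :: real^'n^'m \<Rightarrow> real^'n \<Rightarrow> real^'m)"
    unfolding bilinear_def
    by (auto intro!: linearI simp: matrix_vector_mult_def vec_eq_iff sum.distrib sum_distrib_left algebra_simps)
  then show ?thesis by (simp add: bilinear_conv_bounded_bilinear)
qed

lemmas has_vector_derivative_matrix_vector_mult =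
  bounded_bilinear.has_vector_derivative[OF bounded_bilinear_matrix_vector_mult]

lemma inner_matrix_vector_mult_transpose:
  "x \<bullet> (transpose M *v y) = y \<bullet> (M *v x)" for M :: "real^3^3"
  by (simp del: transpose_matrix_vector
      add: inner_vec_def matrix_vector_mult_def transpose_def sum_3 algebra_simps)

lemma cross3_curl_linear:
  fixes M :: "real^3^3"
  assumes "(F has_derivative (\<lambda>h. M *v h)) (at x)"
  shows "cross3 v (curl F x) = transpose M *v v - M *v v"
proof -
  have "partial_deriv i (\<lambda>z. F z $ j) x = M $ j $ i" for i j
    using partial_deriv_eq[OF bounded_linear.has_derivative[OF bounded_linear_vec_nth assms], of i j]
    by (simp add: matrix_vector_mult_basis column_def)
  then show ?thesis
    by (simp del: transpose_matrix_vector add: curl_def Let_def cross3_def vec_eq_iff forall_3 matrix_vector_mult_def transpose_def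
        sum_3 algebra_simps)
qed

context third_order_potential
begin

text \<open>Apart from the linear one, all terms of the scalar potential have zero gradient at \<open>y = 0\<close>.\<close>

lemma scalar_potential_gradient:
  fixes \<phi> :: "real^3 \<Rightarrow> real" and B C :: "real^3^3"
  assumes t: "t \<in> I"
    and \<phi>: "\<And>y. \<phi> (r + y) = \<phi>0 + y \<bullet> g + (k * ((B *v y) \<bullet> (B *v y))
      - l * (1 / 2 * (y \<bullet> (C *v y)) + pot_t t y) + l * (v \<bullet> grad (P t) y))"
  shows "grad \<phi> r = g"
proof -
  have "partial_deriv i \<phi> r = g $ i" for i
  proof -
    let ?e = "axis i (1::real)"
    have sc: "M *v (h *\<^sub>R ?e) = h *\<^sub>R (M *v ?e)" for M :: "real^3^3" and h
      by (simp add: linear_simps[OF matrix_vector_mul_bounded_linear])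
    have "((\<lambda>h. grad (P t) (h *\<^sub>R ?e)) has_derivative (\<lambda>h. D (t, 0) (0, h *\<^sub>R ?e))) (at 0)"
      by (rule has_derivative_compose[of "\<lambda>h. h *\<^sub>R ?e" "\<lambda>h. h *\<^sub>R ?e" 0 UNIV "grad (P t)"])
        (use grad_has_space_derivative[OF t, of 0] in \<open>auto intro!: derivative_eq_intros\<close>)
    then have "((\<lambda>h. grad (P t) (h *\<^sub>R ?e)) has_vector_derivative 0) (at 0)"
      by (simp add: hessian_zero[OF t] has_vector_derivative_def)
    from bounded_linear.has_vector_derivative[OF bounded_linear_inner_right this, of v]
    have gradP: "((\<lambda>h. v \<bullet> grad (P t) (h *\<^sub>R ?e)) has_real_derivative 0) (at 0)"
      by (simp add: has_real_derivative_iff_has_vector_derivative)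
    have "((\<lambda>h. \<phi>0 + h * (?e \<bullet> g) + (k * (h\<^sup>2 * ((B *v ?e) \<bullet> (B *v ?e)))
      - l * (1 / 2 * (h\<^sup>2 * (?e \<bullet> (C *v ?e))) + pot_t t (h *\<^sub>R ?e)) + l * (v \<bullet> grad (P t) (h *\<^sub>R ?e))))
        has_real_derivative (?e \<bullet> g)) (at 0)"
      by (auto intro!: derivative_eq_intros pot_t_axis_derivative[OF t] gradP)
    then have "((\<lambda>h. \<phi> (r + h *\<^sub>R ?e)) has_real_derivative (g $ i)) (at 0)"
      by (simp add: \<phi> sc power2_eq_square mult.assoc inner_axis' )
    then show ?thesis
      unfolding partial_deriv_def has_real_derivative_iff_has_vector_derivative
      by (rule vector_derivative_at)
  qed
  then show ?thesis by (simp add: grad_def vec_eq_iff)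
qed

text \<open>The field strengths at the moving point only see the terms of the potentials of degree at
  most one in \<open>y\<close>, so \<open>P\<close> does not enter the force. The contribution \<open>- A\<^sub>1 v\<close> of the moving frame to
  \<open>\<partial>\<^sub>t A\<close> cancels against the corresponding half of \<open>v \<times> curl A\<close>.\<close>

lemma lorentz_force:
  fixes A :: "real \<Rightarrow> real^3 \<Rightarrow> real^3" and B C :: "real^3^3"
  assumes t: "t \<in> I"
    and r: "(r has_vector_derivative v) (at t within I)"
    and A0: "(A0 has_vector_derivative A0') (at t within I)"
    and A1: "(A1 has_vector_derivative A1') (at t within I)"
    and A: "\<And>s x. s \<in> I \<Longrightarrow> A s x = A0 s + A1 s *v (x - r s) + grad (P s) (x - r s)"
    and \<phi>: "\<And>y. \<phi> t (r t + y) = \<phi>0 + y \<bullet> g + (k * ((B *v y) \<bullet> (B *v y))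
      - l * (1 / 2 * (y \<bullet> (C *v y)) + pot_t t y) + l * (v \<bullet> grad (P t) y))"
  shows "q *\<^sub>R electric_field c I \<phi> A t (r t) + (q / c) *\<^sub>R cross3 v (magnetic_field A t (r t)) =
    - q *\<^sub>R g - (q / c) *\<^sub>R A0' + (q / c) *\<^sub>R (transpose (A1 t) *v v)"
proof -
  have g: "grad (\<phi> t) (r t) = g"
    by (rule scalar_potential_gradient[OF t \<phi>])
  have w: "((\<lambda>s. r t - r s) has_vector_derivative - v) (at t within I)"
    using r by (auto intro!: derivative_eq_intros)
  have "((\<lambda>s. A0 s + A1 s *v (r t - r s) + grad (P s) (r t - r s)) has_vector_derivative
      A0' + (A1 t *v (- v) + A1' *v (r t - r t)) + (grad_t t (r t - r t) + D (t, r t - r t) (0, - v)))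
      (at t within I)"
    by (intro has_vector_derivative_add A0 has_vector_derivative_matrix_vector_mult A1 w
        grad_along_curve t)
  moreover have "A1 t *v (- v) = - (A1 t *v v)"
    by (rule bounded_bilinear.minus_right[OF bounded_bilinear_matrix_vector_mult])
  ultimately have "((\<lambda>s. A0 s + A1 s *v (r t - r s) + grad (P s) (r t - r s)) has_vector_derivative
      A0' - A1 t *v v) (at t within I)"
    by (simp add: grad_t_zero[OF t] hessian_zero[OF t])
  then have "((\<lambda>s. A s (r t)) has_vector_derivative A0' - A1 t *v v) (at t within I)"
    by (rule has_vector_derivative_transform[OF t A, rotated])
  then have dA: "time_deriv I (\<lambda>s. A s (r t)) t = A0' - A1 t *v v"
    by (rule vector_derivative_within[OF nontrivial[OF t]])
  have sh: "((\<lambda>x. x - r t) has_derivative (\<lambda>h. h)) (at (r t))"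
    by (auto intro!: derivative_eq_intros)
  have "((\<lambda>x. grad (P t) (x - r t)) has_derivative (\<lambda>h. D (t, 0) (0, h))) (at (r t))"
    by (rule has_derivative_compose[OF sh]) (use grad_has_space_derivative[OF t, of 0] in simp)
  moreover have "((\<lambda>x. A1 t *v (x - r t)) has_derivative (\<lambda>h. A1 t *v h)) (at (r t))"
    by (rule bounded_linear.has_derivative[OF matrix_vector_mul_bounded_linear sh])
  ultimately have "((\<lambda>x. A0 t + A1 t *v (x - r t) + grad (P t) (x - r t)) has_derivative
      (\<lambda>h. 0 + A1 t *v h + D (t, 0) (0, h))) (at (r t))"
    by (intro has_derivative_add has_derivative_const)
  then have "(A t has_derivative (\<lambda>h. A1 t *v h)) (at (r t))"
    by (simp add: hessian_zero[OF t] A[OF t, abs_def])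
  then have "cross3 v (magnetic_field A t (r t)) = transpose (A1 t) *v v - A1 t *v v"
    unfolding magnetic_field_def by (rule cross3_curl_linear)
  then show ?thesis
    unfolding electric_field_def g dA
    by (simp del: transpose_matrix_vector add: scaleR_diff_right scaleR_add_right)
qed

end

section \<open>Amplitude and phase of the wave-corpuscle\<close>

lemma rescaled_form_factor:
  fixes a :: real
  assumes ff: "form_factor G1 \<rho>" and a: "a > 0"
  shows "C2 (\<lambda>y. rescaled \<rho> a (norm y))"
    and "laplacian (\<lambda>y. rescaled \<rho> a (norm y)) y =
      G_size G1 a ((rescaled \<rho> a (norm y))\<^sup>2) * rescaled \<rho> a (norm y)"
proof -
  have Q: "C2 (\<lambda>x::real^3. \<rho> (norm x))"
    and eq: "laplacian (\<lambda>z. \<rho> (norm z)) x = G1 ((\<rho> (norm x))\<^sup>2) * \<rho> (norm x)" for x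
    using ff by (auto simp: form_factor_def)
  have R: "(\<lambda>y::real^3. rescaled \<rho> a (norm y)) =
      (\<lambda>y. a powr (- 3 / 2) * \<rho> (norm ((1 / a) *\<^sub>R y)))"
    using a by (auto simp: rescaled_def)
  show "C2 (\<lambda>y. rescaled \<rho> a (norm y))"
    unfolding R by (rule C2_dilation(1)[OF Q])
  have "a ^ 3 * (a powr (- 3 / 2))\<^sup>2 = a powr 3 * (a powr (- 3 / 2) * a powr (- 3 / 2))"
    using a by (simp add: power2_eq_square powr_numeral)
  also have "\<dots> = a powr (3 + (- 3 / 2 + - 3 / 2))" by (simp only: powr_add)
  also have "\<dots> = 1" using a by simp
  finally have "a ^ 3 * (a powr (- 3 / 2) * s)\<^sup>2 = s\<^sup>2" for s
    by (simp add: power_mult_distrib flip: mult.assoc)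
  then have G: "G_size G1 a ((rescaled \<rho> a (norm y))\<^sup>2) = G1 ((\<rho> (norm y / a))\<^sup>2) / a\<^sup>2"
    by (simp add: G_size_def rescaled_def)
  have "laplacian (\<lambda>y. rescaled \<rho> a (norm y)) y =
      a powr (- 3 / 2) * (1 / a)\<^sup>2 * laplacian (\<lambda>z. \<rho> (norm z)) ((1 / a) *\<^sub>R y)"
    by (subst R) (rule C2_dilation(2)[OF Q])
  also have "\<dots> = G_size G1 a ((rescaled \<rho> a (norm y))\<^sup>2) * rescaled \<rho> a (norm y)"
    unfolding eq G using a by (simp add: rescaled_def power_divide)
  finally show "laplacian (\<lambda>y. rescaled \<rho> a (norm y)) y =
      G_size G1 a ((rescaled \<rho> a (norm y))\<^sup>2) * rescaled \<rho> a (norm y)" .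
qed

lemma quadratic_phase:
  fixes P :: "real^3 \<Rightarrow> real" and M :: "real^3^3" and v b :: "real^3" and k l s :: real
  assumes P: "C2 P"
  defines "\<theta> \<equiv> \<lambda>y. k * (v \<bullet> y) + l * (y \<bullet> b) + s + l * (1 / 2 * (y \<bullet> (M *v y)) + P y)"
  shows "C2 \<theta>"
    and "partial_deriv i \<theta> y = (k *\<^sub>R v + l *\<^sub>R (b + (1 / 2) *\<^sub>R ((M + transpose M) *v y) + grad P y)) $ i"
proof -
  have P1: "C1_on UNIV P" "\<And>i. C1_on UNIV (partial_deriv i P)"
    using P by (auto simp: C2_def)
  have "((\<lambda>y. M *v y) has_derivative (\<lambda>h. M *v h)) (at y)" for y
    by (rule bounded_linear_imp_has_derivative) (rule matrix_vector_mul_bounded_linear)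
  then have d: "(\<theta> has_derivative (\<lambda>h. k * (v \<bullet> h) + l * (h \<bullet> b)
      + l * (1 / 2 * (y \<bullet> (M *v h) + h \<bullet> (M *v y)) + grad P y \<bullet> h))) (at y)" for y
    unfolding \<theta>_def
    by (auto intro!: derivative_eq_intros has_derivative_grad C1_on_differentiable P1)
  have e: "axis i 1 \<bullet> x = x $ i" for x :: "real^3" and i by (simp add: inner_axis')
  show pd: "partial_deriv i \<theta> y =
      (k *\<^sub>R v + l *\<^sub>R (b + (1 / 2) *\<^sub>R ((M + transpose M) *v y) + grad P y)) $ i" for i y
  proof -
    have "y \<bullet> (M *v axis i 1) = (transpose M *v y) $ i"
      using inner_matrix_vector_mult_transpose[of "axis i 1" M y] by (simp add: e)
    then show ?thesis
      unfolding partial_deriv_eq[OF d]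
      by (simp del: transpose_matrix_vector add: e inner_axis matrix_vector_mult_add_rdistrib algebra_simps)
  qed
  have C1: "C1_on UNIV (\<lambda>y. partial_deriv i \<theta> y)" for i
  proof -
    have lin: "bounded_linear (\<lambda>y. (l * (1 / 2)) * (((M + transpose M) *v y) $ i))"
      by (intro bounded_linear_compose[OF bounded_linear_mult_right]
          bounded_linear_compose[OF bounded_linear_vec_nth] matrix_vector_mul_bounded_linear)
    have "(\<lambda>y. partial_deriv i \<theta> y) = (\<lambda>y. (k * v $ i + l * b $ i)
        + ((l * (1 / 2)) * (((M + transpose M) *v y) $ i) + l * partial_deriv i P y))"
      by (auto simp: pd algebra_simps grad_def)
    then show ?thesis
      using C1_on_add[OF C1_on_const C1_on_add[OF C1_on_linear[OF lin]
          C1_on_mult[OF C1_on_const P1(2)]]] by simp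
  qed
  then show "C2 \<theta>"
    unfolding C2_def C1_on_UNIV_iff[of \<theta>] using d
    by (auto simp only: differentiable_def intro!: C1_on_imp_continuous_on)
qed

text \<open>The Hamilton--Jacobi equation at one instant and one point. Here \<open>\<theta>'\<close> is the time derivative
  of the phase at a fixed point \<open>x\<close>, at distance vector \<open>y\<close> from the particle; \<open>v'\<close>, \<open>b'\<close>, \<open>M'\<close> are
  the time derivatives of the velocity \<open>v\<close>, of \<open>b = A\<^sub>0\<close> and of \<open>M = A\<^sub>1\<close>, and \<open>pt\<close> and \<open>gP\<close> are the
  time derivative and the gradient of \<open>P\<^sub>3\<close>.\<close>

lemma hamilton_jacobi:
  fixes M M' :: "real^3^3" and v v' y b b' g :: "real^3"
  assumes pos: "m > 0" "chi > 0" "c > 0"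
    and newton: "m *\<^sub>R v' = - q *\<^sub>R g - (q / c) *\<^sub>R b' + (q / c) *\<^sub>R (transpose M *v v)"
    and ab: "ab = (1 / 2) *\<^sub>R ((M - transpose M) *v y)"
    and w: "w = (m / chi) *\<^sub>R v - (q / (chi * c)) *\<^sub>R ab"
    and \<theta>': "\<theta>' = m / chi * (v' \<bullet> y - v \<bullet> v) + q / (chi * c) * (y \<bullet> b' - v \<bullet> b)
      + 1 / chi * (1 / 2 * m * (v \<bullet> v) + q / c * (v \<bullet> b) - q * \<phi>0)
      + q / (chi * c) * (1 / 2 * (y \<bullet> (M' *v y) - (v \<bullet> (M *v y) + y \<bullet> (M *v v)))
        + (pt - v \<bullet> gP))"
    and \<phi>: "\<phi> = \<phi>0 + y \<bullet> g + (- (q / (2 * m * c\<^sup>2)) * (ab \<bullet> ab)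
      - (1 / c) * (1 / 2 * (y \<bullet> (M' *v y)) + pt) + (1 / c) * (v \<bullet> gP))"
  shows "\<theta>' + q / chi * \<phi> = - (chi / (2 * m)) * (w \<bullet> w)"
proof -
  have "m * (v' \<bullet> y) = (m *\<^sub>R v') \<bullet> y" by simp
  also have "\<dots> = - q * (y \<bullet> g) - q / c * (y \<bullet> b') + q / c * (v \<bullet> (M *v y))"
    unfolding newton
    by (simp del: transpose_matrix_vector
        add: inner_diff_right inner_add_right inner_commute[of _ y] inner_matrix_vector_mult_transpose)
  finally have n: "v' \<bullet> y = (- q * (y \<bullet> g) - q / c * (y \<bullet> b') + q / c * (v \<bullet> (M *v y))) / m"
    using pos by (simp add: field_simps)
  have vb: "v \<bullet> ab = 1 / 2 * (v \<bullet> (M *v y) - y \<bullet> (M *v v))"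
    unfolding ab
    by (simp del: transpose_matrix_vector add: matrix_vector_mult_diff_rdistrib inner_diff_right inner_matrix_vector_mult_transpose)
  have ww: "w \<bullet> w = (m / chi)\<^sup>2 * (v \<bullet> v) - 2 * (m / chi) * (q / (chi * c)) * (v \<bullet> ab)
      + (q / (chi * c))\<^sup>2 * (ab \<bullet> ab)"
  proof -
    have "(\<alpha> *\<^sub>R v - \<beta> *\<^sub>R ab) \<bullet> (\<alpha> *\<^sub>R v - \<beta> *\<^sub>R ab) =
        \<alpha>\<^sup>2 * (v \<bullet> v) - 2 * \<alpha> * \<beta> * (v \<bullet> ab) + \<beta>\<^sup>2 * (ab \<bullet> ab)" for \<alpha> \<beta>
      by (simp add: inner_diff_left inner_diff_right inner_commute[of ab v] power2_eq_square algebra_simps)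
    then show ?thesis unfolding w .
  qed
  show ?thesis
    unfolding \<theta>' \<phi> ww vb n using pos by (simp add: field_simps power2_eq_square)
qed

section \<open>The wave-corpuscle is a solution\<close>

theorem theorem4:
  fixes m chi c q a :: real
    and G1 \<rho> :: "real \<Rightarrow> real"
    and I :: "real set"
    and r v g A0 :: "real \<Rightarrow> real^3"
    and \<phi>0 sp :: "real \<Rightarrow> real"
    and A1 :: "real \<Rightarrow> real^3^3"
    and \<phi> \<phi>2 P2 P3 S sp2 :: "real \<Rightarrow> real^3 \<Rightarrow> real"
    and A A_breve :: "real \<Rightarrow> real^3 \<Rightarrow> real^3"
    and \<psi> :: "real \<Rightarrow> real^3 \<Rightarrow> complex"
  assumes constants: "m > 0" "chi > 0" "c > 0" "a > 0"
    and ff: "form_factor G1 \<rho>"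
    and interval: "is_interval I" "0 \<in> I" "I \<noteq> {0}"
    and v: "\<And>t. v t = time_deriv I r t"
    and r_C2: "C1_on I r" "C1_on I v"
    and coeffs_C1: "C1_on I \<phi>0" "C1_on I g" "C1_on I A0" "C1_on I A1"
    and P3_diff: "\<And>t y. t \<in> I \<Longrightarrow> P3 t differentiable (at y)"
    and P3_C1: "C1_on (I \<times> UNIV) (\<lambda>(t, y). grad (P3 t) y)"
    and P3_zero: "\<And>t. t \<in> I \<Longrightarrow> third_degree_zero (P3 t)"
    and P2: "\<And>t y. P2 t y = 1 / 2 * (y \<bullet> (A1 t *v y))"
    and A_breve: "\<And>t y. A_breve t y = (1 / 2) *\<^sub>R ((A1 t - transpose (A1 t)) *v y)"
    and \<phi>2: "\<And>t y. t \<in> I \<Longrightarrow> \<phi>2 t y =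
        - (q / (2 * m * c\<^sup>2)) * (A_breve t y \<bullet> A_breve t y)
        - (1 / c) * time_deriv I (\<lambda>s. P2 s y + P3 s y) t
        + (1 / c) * (v t \<bullet> grad (P3 t) y)"
    and \<phi>: "\<And>t x. t \<in> I \<Longrightarrow>
        \<phi> t x = \<phi>0 t + (x - r t) \<bullet> g t + \<phi>2 t (x - r t)"
    and A: "\<And>t x. t \<in> I \<Longrightarrow>
        A t x = A0 t + A1 t *v (x - r t) + grad (P3 t) (x - r t)"
    and newton: "\<And>t. t \<in> I \<Longrightarrow>
        m *\<^sub>R time_deriv I v t =
          q *\<^sub>R electric_field c I \<phi> A t (r t)
          + (q / c) *\<^sub>R cross3 (v t) (magnetic_field A t (r t))"
    and sp: "\<And>t. sp t = (1 / chi) *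
        (LBINT s=0..t. 1 / 2 * m * (v s \<bullet> v s) + q / c * (v s \<bullet> A0 s) - q * \<phi>0 s)"
    and sp2: "\<And>t y. sp2 t y = q / (chi * c) *
        (LBINT s=0..1. y \<bullet> (A1 t *v (s *\<^sub>R y) + grad (P3 t) (s *\<^sub>R y)))"
    and S: "\<And>t y. S t y =
        m / chi * (v t \<bullet> y) + q / (chi * c) * (y \<bullet> A0 t) + sp t + sp2 t y"
    and \<psi>: "\<And>t x. \<psi> t x =
        exp (\<i> * complex_of_real (S t (x - r t))) * complex_of_real (rescaled \<rho> a (norm (x - r t)))"
  shows "NLS_solution m chi c q (G_size G1 a) I \<phi> A \<psi>"
proof -
  have bot: "at t within I \<noteq> bot" if "t \<in> I" for t
    using at_within_interval_neq_bot[OF interval that] .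
  obtain D where D: "\<And>z. z \<in> I \<times> UNIV \<Longrightarrow>
      ((\<lambda>(t, y). grad (P3 t) y) has_derivative blinfun_apply (D z)) (at z within I \<times> UNIV)"
    "continuous_on (I \<times> UNIV) D"
    using P3_C1 unfolding C1_on_def by blast
  interpret third_order_potential I P3 D
    using interval(1) bot P3_diff D P3_zero
    by unfold_locales (simp_all add: is_interval_convex)
  define R where "R y = rescaled \<rho> a (norm y)" for y :: "real^3"
  have R_C2: "C2 R" and R_eq: "laplacian R y = G_size G1 a ((R y)\<^sup>2) * R y" for y
    using rescaled_form_factor[OF ff constants(4)] unfolding R_def[abs_def] by auto
  have R_diff: "R differentiable (at y)" for y
    using R_C2 by (auto simp: C2_def C1_on_differentiable)
  have R_rad: "R y = R z" if "norm y = norm z" for y z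
    using that by (simp add: R_def)
  define K where "K = q / (chi * c)"

  have S_eq: "S t y = m / chi * (v t \<bullet> y) + K * (y \<bullet> A0 t) + sp t
      + K * (1 / 2 * (y \<bullet> (A1 t *v y)) + P3 t y)" if t: "t \<in> I" for t y
  proof -
    \<comment> \<open>An antiderivative of the integrand defining \<open>sp2\<close>.\<close>
    let ?F = "\<lambda>s. s\<^sup>2 * (1 / 2 * (y \<bullet> (A1 t *v y))) + P3 t (s *\<^sub>R y)"
    have sc: "A1 t *v (s *\<^sub>R y) = s *\<^sub>R (A1 t *v y)" for s
      by (simp add: linear_simps[OF matrix_vector_mul_bounded_linear])
    have "(LBINT s=0..1. y \<bullet> (A1 t *v (s *\<^sub>R y) + grad (P3 t) (s *\<^sub>R y))) =
        (LBINT s=ereal 0..ereal 1. s * (y \<bullet> (A1 t *v y)) + y \<bullet> grad (P3 t) (s *\<^sub>R y))"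
      by (simp add: sc inner_add_right zero_ereal_def one_ereal_def)
    also have "\<dots> = ?F 1 - ?F 0"
    proof (rule interval_integral_FTC_finite)
      show "continuous_on {min 0 1..max 0 1} (\<lambda>s. s * (y \<bullet> (A1 t *v y)) + y \<bullet> grad (P3 t) (s *\<^sub>R y))"
        by (intro continuous_intros continuous_on_segment t)
      show "(?F has_vector_derivative s * (y \<bullet> (A1 t *v y)) + y \<bullet> grad (P3 t) (s *\<^sub>R y))
          (at s within {min 0 1..max 0 1})" for s
      proof (intro has_vector_derivative_add segment_has_vector_derivative t)
        have "((\<lambda>s. s\<^sup>2 * (1 / 2 * (y \<bullet> (A1 t *v y)))) has_real_derivative s * (y \<bullet> (A1 t *v y)))
            (at s within {min 0 1..max 0 1})"
          by (auto intro!: derivative_eq_intros)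
        then show "((\<lambda>s. s\<^sup>2 * (1 / 2 * (y \<bullet> (A1 t *v y)))) has_vector_derivative s * (y \<bullet> (A1 t *v y)))
            (at s within {min 0 1..max 0 1})"
          by (simp add: has_real_derivative_iff_has_vector_derivative)
      qed
    qed
    finally show ?thesis
      unfolding S sp2 K_def using t by simp
  qed

  show ?thesis
    unfolding NLS_solution_def
  proof (intro ballI conjI allI)
    fix t assume t: "t \<in> I"
    define M where "M = - (K / 2) *\<^sub>R (A1 t - transpose (A1 t))"
    define p where "p = (m / chi) *\<^sub>R v t"
    have M: "transpose M = - M"
      by (simp add: M_def transpose_def vec_eq_iff algebra_simps)
    have My: "M *v y = - K *\<^sub>R A_breve t y" for y
      unfolding M_def A_breve
      by (simp add: bounded_bilinear.scaleR_left[OF bounded_bilinear_matrix_vector_mult]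
          bounded_bilinear.minus_left[OF bounded_bilinear_matrix_vector_mult])
    have w: "p + M *v y = (m / chi) *\<^sub>R v t - (q / (chi * c)) *\<^sub>R A_breve t y" for y
      by (simp add: My p_def K_def)
    note phase = quadratic_phase[OF C2_potential[OF t], where k = "m / chi" and v = "v t" and l = K
        and b = "A0 t" and s = "sp t" and M = "A1 t", folded S_eq[OF t]]
    have S_C2: "C2 (S t)" using phase(1) by simp
    have S_diff: "S t differentiable (at y)" for y
      using S_C2 by (auto simp: C2_def C1_on_differentiable)
    have S_w: "partial_deriv i (S t) y - q / (chi * c) * A t (y + r t) $ i = (p + M *v y) $ i" for i y
    proof -
      have "(m / chi) *\<^sub>R v t + K *\<^sub>R (A0 t + (1 / 2) *\<^sub>R ((A1 t + transpose (A1 t)) *v y) + grad (P3 t) y)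
          - K *\<^sub>R A t (y + r t) = p + M *v y"
        unfolding w A[OF t] A_breve K_def[symmetric] matrix_vector_mult_add_rdistrib
          matrix_vector_mult_diff_rdistrib
        by (simp add: vec_eq_iff field_simps)
      from arg_cong[OF this, of "\<lambda>z. z $ i"] show ?thesis
        using phase(2)[of i y] by (simp add: K_def)
    qed
    define F where "F y = exp (\<i> * complex_of_real (S t y)) * complex_of_real (R y)" for y
    have \<psi>_F: "\<psi> t = (\<lambda>x. F (x - r t))"
      by (simp add: fun_eq_iff \<psi> F_def R_def)
    note cov = cov_laplacian_phase_radial[where \<theta> = "S t" and A = "\<lambda>y. A t (y + r t)",
        OF S_diff S_w M R_C2 R_rad, folded F_def]
    show "C2 (\<psi> t)"
      unfolding \<psi>_F using C2_phase[OF S_C2 R_C2, folded F_def] by (rule C2_shift)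
    fix x
    define y where "y = x - r t"
    show "cov_partial q chi c (A t) i (\<psi> t) differentiable (at x)" for i
      unfolding \<psi>_F cov_partial_shift by (rule differentiable_shift) (rule cov(1))

    note dr = C1_on_has_vector_derivative[OF r_C2(1) t, folded v]
      and dv = C1_on_has_vector_derivative[OF r_C2(2) t]
      and dA0 = C1_on_has_vector_derivative[OF coeffs_C1(3) t]
      and dA1 = C1_on_has_vector_derivative[OF coeffs_C1(4) t]
    define v' where "v' = time_deriv I v t"
    define b' where "b' = time_deriv I A0 t"
    define M' where "M' = time_deriv I A1 t"
    have dy: "((\<lambda>s. x - r s) has_vector_derivative - v t) (at t within I)"
      using dr by (auto intro!: derivative_eq_intros)
    have d\<phi>2: "time_deriv I (\<lambda>s. P2 s y + P3 s y) t = 1 / 2 * (y \<bullet> (M' *v y)) + pot_t t y" for y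
    proof (rule vector_derivative_within[OF bot[OF t]])
      have "((\<lambda>s. A1 s *v y) has_vector_derivative A1 t *v 0 + M' *v y) (at t within I)"
        unfolding M'_def
        by (intro has_vector_derivative_matrix_vector_mult dA1 has_vector_derivative_const)
      from bounded_linear.has_vector_derivative[OF bounded_linear_inner_right this, of "(1 / 2) *\<^sub>R y"]
      show "((\<lambda>s. P2 s y + P3 s y) has_vector_derivative 1 / 2 * (y \<bullet> (M' *v y)) + pot_t t y) (at t within I)"
        unfolding P2 by (intro has_vector_derivative_add potential_has_time_derivative t) simp
    qed
    have \<phi>_eq: "\<phi> t (r t + z) = \<phi>0 t + z \<bullet> g t + (- (q / (2 * m * c\<^sup>2)) * (A_breve t z \<bullet> A_breve t z)
      - (1 / c) * (1 / 2 * (z \<bullet> (M' *v z)) + pot_t t z) + (1 / c) * (v t \<bullet> grad (P3 t) z))" for z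
      by (simp add: \<phi>[OF t] \<phi>2[OF t] d\<phi>2)
    have A_breve': "A_breve t z = ((1 / 2) *\<^sub>R (A1 t - transpose (A1 t))) *v z" for z
      unfolding A_breve
      by (simp add: bounded_bilinear.scaleR_left[OF bounded_bilinear_matrix_vector_mult])
    have newton': "m *\<^sub>R v' = - q *\<^sub>R g t - (q / c) *\<^sub>R b' + (q / c) *\<^sub>R (transpose (A1 t) *v v t)"
      unfolding v'_def newton[OF t] b'_def
      by (rule lorentz_force[where r = r and ?A0.0 = A0 and ?A1.0 = A1 and A = A and \<phi> = \<phi>, OF t dr dA0 dA1 A \<phi>_eq[unfolded A_breve']])

    \<comment> \<open>The time derivative of the phase at the fixed point \<open>x\<close>.\<close>
    define \<theta>' where "\<theta>' = m / chi * (v' \<bullet> y - v t \<bullet> v t) + K * (y \<bullet> b' - v t \<bullet> A0 t)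
      + 1 / chi * (1 / 2 * m * (v t \<bullet> v t) + q / c * (v t \<bullet> A0 t) - q * \<phi>0 t)
      + K * (1 / 2 * (y \<bullet> (M' *v y) - (v t \<bullet> (A1 t *v y) + y \<bullet> (A1 t *v v t)))
        + (pot_t t y - v t \<bullet> grad (P3 t) y))"
    note inner_deriv = bounded_bilinear.has_vector_derivative[OF bounded_bilinear_inner]
      and mult_deriv = bounded_linear.has_vector_derivative[OF bounded_linear_mult_right]
    have dS: "((\<lambda>s. S s (x - r s)) has_vector_derivative \<theta>') (at t within I)"
    proof (rule has_vector_derivative_transform[OF t S_eq])
      have cont: "continuous_on I v" "continuous_on I A0" "continuous_on I \<phi>0"
        using r_C2 coeffs_C1 by (auto intro: C1_on_imp_continuous_on)
      have dsp: "(sp has_vector_derivative 1 / chi *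
          (1 / 2 * m * (v t \<bullet> v t) + q / c * (v t \<bullet> A0 t) - q * \<phi>0 t)) (at t within I)"
        unfolding sp[abs_def] zero_ereal_def
        by (intro mult_deriv LBINT_has_vector_derivative_within_interval interval t continuous_intros cont)
      have "((\<lambda>s. m / chi * (v s \<bullet> (x - r s)) + K * ((x - r s) \<bullet> A0 s) + sp s
         + K * (1 / 2 * ((x - r s) \<bullet> (A1 s *v (x - r s))) + P3 s (x - r s))) has_vector_derivative
        m / chi * (v t \<bullet> - v t + v' \<bullet> (x - r t)) + K * ((x - r t) \<bullet> b' + - v t \<bullet> A0 t)
          + 1 / chi * (1 / 2 * m * (v t \<bullet> v t) + q / c * (v t \<bullet> A0 t) - q * \<phi>0 t)
          + K * (1 / 2 * ((x - r t) \<bullet> (A1 t *v - v t + M' *v (x - r t)) + - v t \<bullet> (A1 t *v (x - r t)))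
            + (pot_t t (x - r t) + - v t \<bullet> grad (P3 t) (x - r t)))) (at t within I)"
        (is "(_ has_vector_derivative ?L) _")
        unfolding v'_def b'_def M'_def
        by (intro has_vector_derivative_add mult_deriv inner_deriv has_vector_derivative_matrix_vector_mult
            potential_along_curve dsp dv dy dA0 dA1 t)
      also have "?L = \<theta>'"
        by (simp add: \<theta>'_def y_def inner_add_right inner_diff_right
            bounded_bilinear.minus_right[OF bounded_bilinear_matrix_vector_mult])
      finally show "((\<lambda>s. m / chi * (v s \<bullet> (x - r s)) + K * ((x - r s) \<bullet> A0 s) + sp s
         + K * (1 / 2 * ((x - r s) \<bullet> (A1 s *v (x - r s))) + P3 s (x - r s))) has_vector_derivative \<theta>')
         (at t within I)" .
    qed
    have HJ: "\<theta>' + q / chi * \<phi> t x = - (chi / (2 * m)) * ((p + M *v y) \<bullet> (p + M *v y))"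
      by (rule hamilton_jacobi[OF constants(1-3) newton' A_breve w \<theta>'_def[unfolded K_def]])
        (use \<phi>_eq[of y] in \<open>simp add: y_def\<close>)
    have dR: "((\<lambda>s. R (x - r s)) has_vector_derivative - (v t \<bullet> grad R y)) (at t within I)"
    proof -
      have "(R has_derivative (\<lambda>h. grad R y \<bullet> h)) (at (x - r t))"
        unfolding y_def by (rule has_derivative_grad[OF R_diff])
      from has_derivative_compose[OF dy[unfolded has_vector_derivative_def] this]
      show ?thesis by (simp add: has_vector_derivative_def inner_commute)
    qed
    let ?e = "exp (\<i> * complex_of_real (S t y))"
    have d\<psi>: "((\<lambda>s. \<psi> s x) has_vector_derivative
        ?e * (\<i> * complex_of_real (\<theta>' * R y) - complex_of_real (v t \<bullet> grad R y))) (at t within I)"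
    proof -
      have "((\<lambda>s. exp (\<i> * complex_of_real (S s (x - r s)))) has_vector_derivative
          ?e * (\<i> * complex_of_real \<theta>')) (at t within I)"
        using has_derivative_phase[OF dS[unfolded has_vector_derivative_def]]
        by (simp add: has_vector_derivative_def scaleR_conv_of_real y_def mult_ac)
      from has_vector_derivative_mult[OF this has_vector_derivative_of_real[OF dR[folded has_real_derivative_iff_has_vector_derivative]]]
      show ?thesis
        by (simp add: \<psi> R_def[symmetric] y_def[symmetric] algebra_simps)
    qed
    then show "(\<lambda>s. \<psi> s x) differentiable (at t within I)"
      by (auto simp: has_vector_derivative_def differentiable_def)
    have td: "time_deriv I (\<lambda>s. \<psi> s x) t =
        ?e * (\<i> * complex_of_real (\<theta>' * R y) - complex_of_real (v t \<bullet> grad R y))"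
      by (rule vector_derivative_within[OF bot[OF t] d\<psi>])
    have \<psi>x: "\<psi> t x = ?e * complex_of_real (R y)"
      by (simp add: \<psi>_F F_def y_def)
    have cm: "(cmod (?e * complex_of_real (R y)))\<^sup>2 = (R y)\<^sup>2"
      by (simp add: norm_mult)
    have lhs: "\<i> * cov_time_deriv q chi I \<phi> \<psi> t x =
        ?e * (- complex_of_real ((\<theta>' + q / chi * \<phi> t x) * R y) - \<i> * complex_of_real (v t \<bullet> grad R y))"
      unfolding cov_time_deriv_def td \<psi>x by (simp add: algebra_simps)
    have cl: "cov_laplacian q chi c (A t) (\<psi> t) x = ?e *
      (complex_of_real (laplacian R y - (p + M *v y) \<bullet> (p + M *v y) * R y)
        + 2 * \<i> * complex_of_real (p \<bullet> grad R y))"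
      unfolding \<psi>_F cov_laplacian_shift y_def[symmetric] by (rule cov(2))
    have vp: "v t \<bullet> grad R y = chi / m * (p \<bullet> grad R y)"
      using constants by (simp add: p_def)
    show "\<i> * cov_time_deriv q chi I \<phi> \<psi> t x =
            complex_of_real (chi / (2 * m)) *
              (- cov_laplacian q chi c (A t) (\<psi> t) x
               + complex_of_real (G_size G1 a ((cmod (\<psi> t x))\<^sup>2)) * \<psi> t x)"
      unfolding lhs HJ cl \<psi>x cm R_eq vp
      by (simp add: algebra_simps)
  qed
qed

end
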